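(* Let $\mathbf{H}$ be a differentially cohesive topos and let $\Sigma$ be a $V$-manifold in $\mathbf{H}$ (for some group object $V$ in $\mathbf{H}$). Then there is an equivalence of categories $$\mathrm{PDE}_{/\Sigma}(\mathbf{H})\simeq\mathrm{EM}(J^\infty_\Sigma)$$ between the category of formally integrable generalized PDEs in $\mathbf{H}$ over $\Sigma$ and the Eilenberg–Moore category of coalgebras over the jet comonad $J^\infty_\Sigma:\mathbf{H}_{/\Sigma}\to\mathbf{H}_{/\Sigma}$. Moreover, for any full subcategory $\mathcal{C}\hookrightarrow\mathbf{H}_{/\Sigma}$ to which $J^\infty_\Sigma$ restricts (i.e. closed under $J^\infty_\Sigma$), the equivalence restricts to an equivalence of the corresponding full subcategories $\mathrm{PDE}(\mathcal{C})\simeq\mathrm{EM}(J^\infty_\Sigma|_{\mathcal{C}})$, meaning that the following square commutes, with vertical arrows the full inclusions: $$\begin{array}{ccc}\mathrm{PDE}(\mathcal{C})&\xrightarrow{\simeq}&\mathrm{EM}(J^\infty_\Sigma|_{\mathcal{C}})\\ \downarrow&&\downarrow\\ \mathrm{PDE}_{/\Sigma}(\mathbf{H})&\xrightarrow{\simeq}&\mathrm{EM}(J^\infty_\Sigma).\end{array}$$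
   Context: **Differential cohesion.** A differentially cohesive topos is a (Grothendieck) topos $\mathbf{H}$ with a full inclusion of toposes $i_!:\mathbf{H}_\Re\hookrightarrow\mathbf{H}$ having three successive right adjoints, $i_!\dashv i^\ast\dashv i_\ast\dashv i^!$. Set $\Im:=i_\ast i^\ast$ with unit $\eta:\mathrm{id}\to\Im$. A morphism $f:X\to Y$ is formally étale if the naturality square of $\eta$ on $f$ is a pullback. For $V$ a group object in $\mathbf{H}$, a $V$-manifold is an object $X$ for which there is a span $V\leftarrow U\to X$ with both legs formally étale and the right leg an epimorphism. **Disk bundles and jets.** For $f:X\to Y$ there is the base change triple $f_!\dashv f^\ast\dashv f_\ast$ between slices. Set $T^\infty_\Sigma:=(\eta_\Sigma)^\ast(\eta_\Sigma)_!$ (a monad on $\mathbf{H}_{/\Sigma}$, unit $\eta^T$, product $\nabla$) and $J^\infty_\Sigma:=(\eta_\Sigma)^\ast(\eta_\Sigma)_\ast$ (a comonad, counit $\epsilon$, coproduct $\Delta$); $T^\infty_\Sigma\dashv J^\infty_\Sigma$. For $\sigma:T^\infty_\Sigma X\to Y$ write $\widetilde\sigma:X\to J^\infty_\Sigma Y$ for its adjunct. **Generalized PDEs.** A generalized PDE over $\Sigma$ is a monomorphism $e_Y:\mathcal{E}\hookrightarrow J^\infty_\Sigma Y$ in $\mathbf{H}_{/\Sigma}$. For $E\in\mathbf{H}_{/\Sigma}$, an $E$-parametrized family of formally holonomic sections of $J^\infty_\Sigma Y$ is a morphism $\sigma_E:T^\infty_\Sigma E\to J^\infty_\Sigma Y$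 with $\Delta_Y\circ\sigma_E\circ\eta^T_E=\widetilde{\sigma_E}:E\to J^\infty_\Sigma J^\infty_\Sigma Y$. An $E$-parametrized family of formal solutions of $\mathcal{E}\hookrightarrow J^\infty_\Sigma Y$ is a morphism $s_E:T^\infty_\Sigma E\to\mathcal{E}$ such that $e_Y\circ s_E$ is a family of formally holonomic sections. The prolongation $e^\infty_Y:\mathcal{E}^\infty\hookrightarrow J^\infty_\Sigma Y$ is the pullback of $J^\infty_\Sigma e_Y:J^\infty_\Sigma\mathcal{E}\to J^\infty_\Sigma J^\infty_\Sigma Y$ along $\Delta_Y$, with other projection $\rho^\infty_{\mathcal{E}}:\mathcal{E}^\infty\to J^\infty_\Sigma\mathcal{E}$; its canonical inclusion is $e^\infty_{\mathcal{E}}:=\epsilon_{\mathcal{E}}\circ\rho^\infty_{\mathcal{E}}:\mathcal{E}^\infty\hookrightarrow\mathcal{E}$. The PDE is formally integrable if $e^\infty_{\mathcal{E}}$ is an isomorphism. A morphism $\phi:\mathcal{E}\to\mathcal{E}'$ in $\mathbf{H}_{/\Sigma}$ between (underlying objects of) generalized PDEs preserves formal solutions if for every parametrized family of formal solutions $\sigma:T^\infty_\Sigma E\to\mathcal{E}$ the composite $\phi\circ\sigma$ is a parametrized family of formal solutions of $\mathcal{E}'$. $\mathrm{PDE}_{/\Sigma}(\mathbf{H})$ has as objects the formally integrable generalized PDEs $\mathcal{E}\hookrightarrow J^\infty_\Sigma Y$ and as morphisms the $\mathbf{H}_{/\Sigma}$-morphisms $\mathcal{E}\to\mathcal{E}'$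 preserving formal solutions. $\mathrm{PDE}(\mathcal{C})$ is its full subcategory on those objects with $\mathcal{E},Y\in\mathcal{C}$. **Coalgebras.** $\mathrm{EM}(J)$ has objects $(\mathcal{E},\rho:\mathcal{E}\to J\mathcal{E})$ with $\epsilon_{\mathcal{E}}\circ\rho=\mathrm{id}$ and $J\rho\circ\rho=\Delta_{\mathcal{E}}\circ\rho$; morphisms are maps $\phi$ with $\rho'\circ\phi=J\phi\circ\rho$. *)

theory Defs
  imports Main "HOL-Library.FuncSet" "HOL-Library.Equipollence"
begin

section \<open>Categories and functors\<close>

text \<open>All structures are carrier-based: objects and arrows are sets inside HOL types, so that slices,
  full subcategories, sheaf categories and categories of coalgebras are again of this form.\<close>

record ('o, 'm) cat =
  Ob :: "'o set"
  Ar :: "'m set"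
  Dom :: "'m \<Rightarrow> 'o"
  Cod :: "'m \<Rightarrow> 'o"
  Id :: "'o \<Rightarrow> 'm"
  cmp :: "'m \<Rightarrow> 'm \<Rightarrow> 'm"  (infixr "\<odot>\<index>" 70)

definition hom :: "('o, 'm) cat \<Rightarrow> 'o \<Rightarrow> 'o \<Rightarrow> 'm set" where
  "hom C a b = {f \<in> Ar C. Dom C f = a \<and> Cod C f = b}"

definition category :: "('o, 'm) cat \<Rightarrow> bool" where
  "category C \<longleftrightarrow>
     (\<forall>f \<in> Ar C. Dom C f \<in> Ob C \<and> Cod C f \<in> Ob C) \<and>
     (\<forall>a \<in> Ob C. Id C a \<in> hom C a a) \<and>
     (\<forall>f \<in> Ar C. \<forall>g \<in> Ar C. Dom C g = Cod C f \<longrightarrow> g \<odot>\<^bsub>C\<^esub> f \<in> hom C (Dom C f) (Cod C g)) \<and>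
     (\<forall>f \<in> Ar C. f \<odot>\<^bsub>C\<^esub> Id C (Dom C f) = f \<and> Id C (Cod C f) \<odot>\<^bsub>C\<^esub> f = f) \<and>
     (\<forall>f \<in> Ar C. \<forall>g \<in> Ar C. \<forall>h \<in> Ar C. Dom C g = Cod C f \<and> Dom C h = Cod C g \<longrightarrow>
        h \<odot>\<^bsub>C\<^esub> (g \<odot>\<^bsub>C\<^esub> f) = (h \<odot>\<^bsub>C\<^esub> g) \<odot>\<^bsub>C\<^esub> f)"

record ('o, 'm, 'p, 'n) ftr =
  fob :: "'o \<Rightarrow> 'p"
  far :: "'m \<Rightarrow> 'n"

definition is_ftr :: "('o, 'm) cat \<Rightarrow> ('p, 'n) cat \<Rightarrow> ('o, 'm, 'p, 'n) ftr \<Rightarrow> bool" where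
  "is_ftr C D F \<longleftrightarrow> category C \<and> category D \<and>
     (\<forall>a \<in> Ob C. fob F a \<in> Ob D) \<and>
     (\<forall>f \<in> Ar C. far F f \<in> hom D (fob F (Dom C f)) (fob F (Cod C f))) \<and>
     (\<forall>a \<in> Ob C. far F (Id C a) = Id D (fob F a)) \<and>
     (\<forall>f \<in> Ar C. \<forall>g \<in> Ar C. Dom C g = Cod C f \<longrightarrow>
        far F (g \<odot>\<^bsub>C\<^esub> f) = far F g \<odot>\<^bsub>D\<^esub> far F f)"

definition id_ftr :: "('o, 'm, 'o, 'm) ftr" where
  "id_ftr = \<lparr>fob = (\<lambda>a. a), far = (\<lambda>f. f)\<rparr>"

definition comp_ftr ::
  "('p, 'n, 'q, 'k) ftr \<Rightarrow> ('o, 'm, 'p, 'n) ftr \<Rightarrow> ('o, 'm, 'q, 'k) ftr"  (infixr "\<circ>\<^sub>F" 55) where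
  "G \<circ>\<^sub>F F = \<lparr>fob = fob G \<circ> fob F, far = far G \<circ> far F\<rparr>"

text \<open>Equality of two functors on \<open>C\<close>; equality of the records would also compare values outside \<open>C\<close>.\<close>

definition ftr_eq :: "('o, 'm) cat \<Rightarrow> ('o, 'm, 'p, 'n) ftr \<Rightarrow> ('o, 'm, 'p, 'n) ftr \<Rightarrow> bool" where
  "ftr_eq C F G \<longleftrightarrow> (\<forall>a \<in> Ob C. fob F a = fob G a) \<and> (\<forall>f \<in> Ar C. far F f = far G f)"

definition fully_faithful ::
  "('o, 'm) cat \<Rightarrow> ('p, 'n) cat \<Rightarrow> ('o, 'm, 'p, 'n) ftr \<Rightarrow> bool" where
  "fully_faithful C D F \<longleftrightarrow> is_ftr C D F \<and>
     (\<forall>a \<in> Ob C. \<forall>b \<in> Ob C. bij_betw (far F) (hom C a b) (hom D (fob F a) (fob F b)))"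

definition nat_trans ::
  "('o, 'm) cat \<Rightarrow> ('p, 'n) cat \<Rightarrow> ('o, 'm, 'p, 'n) ftr \<Rightarrow> ('o, 'm, 'p, 'n) ftr \<Rightarrow> ('o \<Rightarrow> 'n) \<Rightarrow> bool" where
  "nat_trans C D F G \<tau> \<longleftrightarrow> is_ftr C D F \<and> is_ftr C D G \<and>
     (\<forall>a \<in> Ob C. \<tau> a \<in> hom D (fob F a) (fob G a)) \<and>
     (\<forall>f \<in> Ar C. \<tau> (Cod C f) \<odot>\<^bsub>D\<^esub> far F f = far G f \<odot>\<^bsub>D\<^esub> \<tau> (Dom C f))"

definition iso :: "('o, 'm) cat \<Rightarrow> 'm \<Rightarrow> bool" where
  "iso C f \<longleftrightarrow> f \<in> Ar C \<and>
     (\<exists>g \<in> hom C (Cod C f) (Dom C f). g \<odot>\<^bsub>C\<^esub> f = Id C (Dom C f) \<and> f \<odot>\<^bsub>C\<^esub> g = Id C (Cod C f))"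

definition nat_iso ::
  "('o, 'm) cat \<Rightarrow> ('p, 'n) cat \<Rightarrow> ('o, 'm, 'p, 'n) ftr \<Rightarrow> ('o, 'm, 'p, 'n) ftr \<Rightarrow> ('o \<Rightarrow> 'n) \<Rightarrow> bool" where
  "nat_iso C D F G \<tau> \<longleftrightarrow> nat_trans C D F G \<tau> \<and> (\<forall>a \<in> Ob C. iso D (\<tau> a))"

definition equivalence ::
  "('o, 'm) cat \<Rightarrow> ('p, 'n) cat \<Rightarrow> ('o, 'm, 'p, 'n) ftr \<Rightarrow> bool" where
  "equivalence C D F \<longleftrightarrow> is_ftr C D F \<and>
     (\<exists>G \<eta> \<epsilon>. is_ftr D C G \<and> nat_iso C C id_ftr (G \<circ>\<^sub>F F) \<eta> \<and> nat_iso D D (F \<circ>\<^sub>F G) id_ftr \<epsilon>)"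

text \<open>\<open>F : C \<rightarrow> D\<close> is left adjoint to \<open>G : D \<rightarrow> C\<close>, with unit \<open>\<eta>\<close> and counit \<open>\<epsilon>\<close>.\<close>

definition adjunction ::
  "('o, 'm) cat \<Rightarrow> ('p, 'n) cat \<Rightarrow> ('o, 'm, 'p, 'n) ftr \<Rightarrow> ('p, 'n, 'o, 'm) ftr \<Rightarrow>
   ('o \<Rightarrow> 'm) \<Rightarrow> ('p \<Rightarrow> 'n) \<Rightarrow> bool" where
  "adjunction C D F G \<eta> \<epsilon> \<longleftrightarrow> is_ftr C D F \<and> is_ftr D C G \<and>
     nat_trans C C id_ftr (G \<circ>\<^sub>F F) \<eta> \<and> nat_trans D D (F \<circ>\<^sub>F G) id_ftr \<epsilon> \<and>
     (\<forall>a \<in> Ob C. \<epsilon> (fob F a) \<odot>\<^bsub>D\<^esub> far F (\<eta> a) = Id D (fob F a)) \<and>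
     (\<forall>b \<in> Ob D. far G (\<epsilon> b) \<odot>\<^bsub>C\<^esub> \<eta> (fob G b) = Id C (fob G b))"

definition full_subcat :: "('o, 'm) cat \<Rightarrow> 'o set \<Rightarrow> ('o, 'm) cat" where
  "full_subcat C X =
     C\<lparr>Ob := Ob C \<inter> X, Ar := {f \<in> Ar C. Dom C f \<in> X \<and> Cod C f \<in> X}\<rparr>"

definition opposite :: "('o, 'm) cat \<Rightarrow> ('o, 'm) cat" where
  "opposite C = \<lparr>Ob = Ob C, Ar = Ar C, Dom = Cod C, Cod = Dom C, Id = Id C, cmp = (\<lambda>g f. f \<odot>\<^bsub>C\<^esub> g)\<rparr>"

text \<open>An arrow of the functor category is a triple (source, components, target); the values outside
  the domain are normalised, so that equality of objects and arrows is the intended one.\<close>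

definition ftr_cat :: "('o, 'm) cat \<Rightarrow> ('p, 'n) cat \<Rightarrow>
    (('o, 'm, 'p, 'n) ftr, ('o, 'm, 'p, 'n) ftr \<times> ('o \<Rightarrow> 'n) \<times> ('o, 'm, 'p, 'n) ftr) cat" where
  "ftr_cat C D = (let Fs = {F. is_ftr C D F \<and> fob F \<in> extensional (Ob C) \<and> far F \<in> extensional (Ar C)} in
     \<lparr>Ob = Fs,
      Ar = {(F, \<tau>, G). F \<in> Fs \<and> G \<in> Fs \<and> nat_trans C D F G \<tau> \<and> \<tau> \<in> extensional (Ob C)},
      Dom = (\<lambda>(F, \<tau>, G). F),
      Cod = (\<lambda>(F, \<tau>, G). G),
      Id = (\<lambda>F. (F, (\<lambda>a \<in> Ob C. Id D (fob F a)), F)),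
      cmp = (\<lambda>(_, \<sigma>, H) (F, \<tau>, _). (F, (\<lambda>a \<in> Ob C. \<sigma> a \<odot>\<^bsub>D\<^esub> \<tau> a), H))\<rparr>)"


section \<open>Limits, monomorphisms, group objects\<close>

definition monic :: "('o, 'm) cat \<Rightarrow> 'm \<Rightarrow> bool" where
  "monic C f \<longleftrightarrow> f \<in> Ar C \<and>
     (\<forall>g \<in> Ar C. \<forall>h \<in> Ar C. Cod C g = Dom C f \<and> Cod C h = Dom C f \<and> Dom C g = Dom C h \<and>
        f \<odot>\<^bsub>C\<^esub> g = f \<odot>\<^bsub>C\<^esub> h \<longrightarrow> g = h)"

definition epic :: "('o, 'm) cat \<Rightarrow> 'm \<Rightarrow> bool" where
  "epic C f \<longleftrightarrow> f \<in> Ar C \<and>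
     (\<forall>g \<in> Ar C. \<forall>h \<in> Ar C. Dom C g = Cod C f \<and> Dom C h = Cod C f \<and> Cod C g = Cod C h \<and>
        g \<odot>\<^bsub>C\<^esub> f = h \<odot>\<^bsub>C\<^esub> f \<longrightarrow> g = h)"

definition terminal :: "('o, 'm) cat \<Rightarrow> 'o \<Rightarrow> bool" where
  "terminal C t \<longleftrightarrow> t \<in> Ob C \<and> (\<forall>a \<in> Ob C. \<exists>!f. f \<in> hom C a t)"

definition to_terminal :: "('o, 'm) cat \<Rightarrow> 'o \<Rightarrow> 'o \<Rightarrow> 'm" where
  "to_terminal C t a = (THE f. f \<in> hom C a t)"

text \<open>\<open>p, q\<close> are the projections of a product of \<open>Cod C p\<close> and \<open>Cod C q\<close>.\<close>

definition is_product :: "('o, 'm) cat \<Rightarrow> 'm \<Rightarrow> 'm \<Rightarrow> bool" where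
  "is_product C p q \<longleftrightarrow> p \<in> Ar C \<and> q \<in> Ar C \<and> Dom C p = Dom C q \<and>
     (\<forall>x \<in> Ob C. \<forall>f \<in> hom C x (Cod C p). \<forall>g \<in> hom C x (Cod C q).
        \<exists>!h. h \<in> hom C x (Dom C p) \<and> p \<odot>\<^bsub>C\<^esub> h = f \<and> q \<odot>\<^bsub>C\<^esub> h = g)"

definition pairing :: "('o, 'm) cat \<Rightarrow> 'm \<Rightarrow> 'm \<Rightarrow> 'm \<Rightarrow> 'm \<Rightarrow> 'm" where
  "pairing C p q f g =
     (THE h. h \<in> hom C (Dom C f) (Dom C p) \<and> p \<odot>\<^bsub>C\<^esub> h = f \<and> q \<odot>\<^bsub>C\<^esub> h = g)"

text \<open>\<open>p, q\<close> are the projections of a pullback of the cospan \<open>f, g\<close>, i.e.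
  \<open>f \<odot> p = g \<odot> q\<close> is a pullback square.\<close>

definition is_pullback :: "('o, 'm) cat \<Rightarrow> 'm \<Rightarrow> 'm \<Rightarrow> 'm \<Rightarrow> 'm \<Rightarrow> bool" where
  "is_pullback C f g p q \<longleftrightarrow>
     f \<in> Ar C \<and> g \<in> Ar C \<and> Cod C f = Cod C g \<and>
     p \<in> Ar C \<and> q \<in> Ar C \<and> Dom C p = Dom C q \<and> Cod C p = Dom C f \<and> Cod C q = Dom C g \<and>
     f \<odot>\<^bsub>C\<^esub> p = g \<odot>\<^bsub>C\<^esub> q \<and>
     (\<forall>x \<in> Ob C. \<forall>u \<in> hom C x (Dom C f). \<forall>v \<in> hom C x (Dom C g). f \<odot>\<^bsub>C\<^esub> u = g \<odot>\<^bsub>C\<^esub> v \<longrightarrow>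
        (\<exists>!h. h \<in> hom C x (Dom C p) \<and> p \<odot>\<^bsub>C\<^esub> h = u \<and> q \<odot>\<^bsub>C\<^esub> h = v))"

text \<open>Here \<open>p, q : V \<times> V \<rightarrow> V\<close> and \<open>r : (V \<times> V) \<times> V \<rightarrow> V \<times> V\<close>, \<open>s : (V \<times> V) \<times> V \<rightarrow> V\<close> are the
  projections, and \<open>m, e, i\<close> are multiplication, unit and inversion.\<close>

definition group_object :: "('o, 'm) cat \<Rightarrow> 'o \<Rightarrow> bool" where
  "group_object C V \<longleftrightarrow> V \<in> Ob C \<and>
     (\<exists>t p q r s m e i.
        terminal C t \<and>
        is_product C p q \<and> Cod C p = V \<and> Cod C q = V \<and>
        is_product C r s \<and> Cod C r = Dom C p \<and> Cod C s = V \<and>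
        m \<in> hom C (Dom C p) V \<and> e \<in> hom C t V \<and> i \<in> hom C V V \<and>
        m \<odot>\<^bsub>C\<^esub> pairing C p q (m \<odot>\<^bsub>C\<^esub> r) s
          = m \<odot>\<^bsub>C\<^esub> pairing C p q (p \<odot>\<^bsub>C\<^esub> r) (m \<odot>\<^bsub>C\<^esub> pairing C p q (q \<odot>\<^bsub>C\<^esub> r) s) \<and>
        m \<odot>\<^bsub>C\<^esub> pairing C p q (e \<odot>\<^bsub>C\<^esub> to_terminal C t V) (Id C V) = Id C V \<and>
        m \<odot>\<^bsub>C\<^esub> pairing C p q (Id C V) (e \<odot>\<^bsub>C\<^esub> to_terminal C t V) = Id C V \<and>
        m \<odot>\<^bsub>C\<^esub> pairing C p q i (Id C V) = e \<odot>\<^bsub>C\<^esub> to_terminal C t V \<and>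
        m \<odot>\<^bsub>C\<^esub> pairing C p q (Id C V) i = e \<odot>\<^bsub>C\<^esub> to_terminal C t V)"


section \<open>Grothendieck toposes\<close>

text \<open>Sets are taken relative to a universe, presented by a type \<open>'u\<close>: the small sets are the
  subsets of \<open>'u\<close> of smaller cardinality than \<open>'u\<close>, and they are required to be closed under power
  sets and small unions. For uncountable \<open>'u\<close> this says that the cardinality of \<open>'u\<close> is strongly
  inaccessible, i.e. that of a Grothendieck universe; the countable universe, in which all sets are
  finite, is also admitted. Every small set is in bijection with a small subset of \<open>'u\<close>, and every
  small category is isomorphic to one whose objects and arrows are elements of \<open>'u\<close>.\<close>

definition small :: "'u set \<Rightarrow> bool" where
  "small A \<longleftrightarrow> A \<prec> (UNIV :: 'u set)"

definition grothendieck_universe :: "'u itself \<Rightarrow> bool" where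
  "grothendieck_universe _ \<longleftrightarrow> infinite (UNIV :: 'u set) \<and>
     (\<forall>A :: 'u set. small A \<longrightarrow> Pow A \<prec> (UNIV :: 'u set)) \<and>
     (\<forall>(I :: 'u set) (A :: 'u \<Rightarrow> 'u set). small I \<and> (\<forall>i \<in> I. small (A i)) \<longrightarrow> small (\<Union>i \<in> I. A i))"

definition set_cat :: "('u set, 'u set \<times> ('u \<Rightarrow> 'u) \<times> 'u set) cat" where
  "set_cat =
     \<lparr>Ob = {A. small A},
      Ar = {(A, f, B). small A \<and> small B \<and> f \<in> A \<rightarrow>\<^sub>E B},
      Dom = (\<lambda>(A, f, B). A),
      Cod = (\<lambda>(A, f, B). B),
      Id = (\<lambda>A. (A, (\<lambda>x \<in> A. x), A)),
      cmp = (\<lambda>(_, g, D) (A, f, _). (A, (\<lambda>x \<in> A. g (f x)), D))\<rparr>"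

definition sieve :: "('o, 'm) cat \<Rightarrow> 'o \<Rightarrow> 'm set \<Rightarrow> bool" where
  "sieve C c S \<longleftrightarrow> S \<subseteq> {f \<in> Ar C. Cod C f = c} \<and>
     (\<forall>f \<in> S. \<forall>g \<in> Ar C. Cod C g = Dom C f \<longrightarrow> f \<odot>\<^bsub>C\<^esub> g \<in> S)"

definition pull_sieve :: "('o, 'm) cat \<Rightarrow> 'm \<Rightarrow> 'm set \<Rightarrow> 'm set" where
  "pull_sieve C h S = {g \<in> Ar C. Cod C g = Dom C h \<and> h \<odot>\<^bsub>C\<^esub> g \<in> S}"

definition grothendieck_topology :: "('o, 'm) cat \<Rightarrow> ('o \<Rightarrow> 'm set set) \<Rightarrow> bool" where
  "grothendieck_topology C J \<longleftrightarrow>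
     (\<forall>c \<in> Ob C. \<forall>S \<in> J c. sieve C c S) \<and>
     (\<forall>c \<in> Ob C. {f \<in> Ar C. Cod C f = c} \<in> J c) \<and>
     (\<forall>h \<in> Ar C. \<forall>S \<in> J (Cod C h). pull_sieve C h S \<in> J (Dom C h)) \<and>
     (\<forall>c \<in> Ob C. \<forall>S \<in> J c. \<forall>R. sieve C c R \<and> (\<forall>h \<in> S. pull_sieve C h R \<in> J (Dom C h)) \<longrightarrow> R \<in> J c)"

abbreviation restriction ::
  "('o, 'm, 'u set, 'u set \<times> ('u \<Rightarrow> 'u) \<times> 'u set) ftr \<Rightarrow> 'm \<Rightarrow> 'u \<Rightarrow> 'u" where
  "restriction F f \<equiv> fst (snd (far F f))"

definition is_sheaf :: "('o, 'm) cat \<Rightarrow> ('o \<Rightarrow> 'm set set) \<Rightarrow>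
    ('o, 'm, 'u set, 'u set \<times> ('u \<Rightarrow> 'u) \<times> 'u set) ftr \<Rightarrow> bool" where
  "is_sheaf C J F \<longleftrightarrow> is_ftr (opposite C) set_cat F \<and>
     (\<forall>c \<in> Ob C. \<forall>S \<in> J c. \<forall>x.
        (\<forall>f \<in> S. x f \<in> fob F (Dom C f)) \<and>
        (\<forall>f \<in> S. \<forall>g \<in> Ar C. Cod C g = Dom C f \<longrightarrow> restriction F g (x f) = x (f \<odot>\<^bsub>C\<^esub> g)) \<longrightarrow>
        (\<exists>!a. a \<in> fob F c \<and> (\<forall>f \<in> S. restriction F f a = x f)))"

definition sheaf_cat where
  "sheaf_cat C J = full_subcat (ftr_cat (opposite C) set_cat) {F. is_sheaf C J F}"

definition grothendieck_topos :: "'u itself \<Rightarrow> ('o, 'm) cat \<Rightarrow> bool" where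
  "grothendieck_topos _ H \<longleftrightarrow> category H \<and>
     (\<exists>(C :: ('u, 'u) cat) J E. category C \<and> small (Ob C) \<and> small (Ar C) \<and> grothendieck_topology C J \<and>
        equivalence H (sheaf_cat C J :: (('u, 'u, 'u set, 'u set \<times> ('u \<Rightarrow> 'u) \<times> 'u set) ftr, _) cat) E)"


section \<open>Differential cohesion\<close>

text \<open>The functors \<open>i_sh\<close>, \<open>i_up\<close>, \<open>i_dn\<close>, \<open>i_ush\<close> are \<open>i\<^sub>!\<close>, \<open>i\<^sup>*\<close>, \<open>i\<^sub>*\<close>, \<open>i\<^sup>!\<close>, and \<open>Im_unit\<close> is the
  unit of \<open>i\<^sup>* \<stileturn> i\<^sub>*\<close>.\<close>

record ('o, 'm, 'p, 'n) diff_cohesion =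
  ambient :: "('o, 'm) cat"
  reduced :: "('p, 'n) cat"
  i_sh :: "('p, 'n, 'o, 'm) ftr"
  i_up :: "('o, 'm, 'p, 'n) ftr"
  i_dn :: "('p, 'n, 'o, 'm) ftr"
  i_ush :: "('o, 'm, 'p, 'n) ftr"
  Im_unit :: "'o \<Rightarrow> 'm"

definition differentially_cohesive_topos ::
  "'u itself \<Rightarrow> ('o, 'm, 'p, 'n) diff_cohesion \<Rightarrow> bool" where
  "differentially_cohesive_topos U K \<longleftrightarrow>
     grothendieck_topos U (ambient K) \<and> grothendieck_topos U (reduced K) \<and>
     fully_faithful (reduced K) (ambient K) (i_sh K) \<and>
     (\<exists>\<eta> \<epsilon>. adjunction (reduced K) (ambient K) (i_sh K) (i_up K) \<eta> \<epsilon>) \<and>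
     (\<exists>\<epsilon>. adjunction (ambient K) (reduced K) (i_up K) (i_dn K) (Im_unit K) \<epsilon>) \<and>
     (\<exists>\<eta> \<epsilon>. adjunction (reduced K) (ambient K) (i_dn K) (i_ush K) \<eta> \<epsilon>)"

definition Im :: "('o, 'm, 'p, 'n) diff_cohesion \<Rightarrow> ('o, 'm, 'o, 'm) ftr" where
  "Im K = i_dn K \<circ>\<^sub>F i_up K"

definition formally_etale :: "('o, 'm, 'p, 'n) diff_cohesion \<Rightarrow> 'm \<Rightarrow> bool" where
  "formally_etale K f \<longleftrightarrow> f \<in> Ar (ambient K) \<and>
     is_pullback (ambient K) (far (Im K) f) (Im_unit K (Cod (ambient K) f))
       (Im_unit K (Dom (ambient K) f)) f"

definition V_manifold :: "('o, 'm, 'p, 'n) diff_cohesion \<Rightarrow> 'o \<Rightarrow> 'o \<Rightarrow> bool" where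
  "V_manifold K V X \<longleftrightarrow> X \<in> Ob (ambient K) \<and>
     (\<exists>U. \<exists>l \<in> hom (ambient K) U V. \<exists>r \<in> hom (ambient K) U X.
        formally_etale K l \<and> formally_etale K r \<and> epic (ambient K) r)"


section \<open>Slices and base change\<close>

text \<open>The objects over \<open>x\<close> are the arrows into \<open>x\<close>; an arrow over \<open>x\<close> is a triple (source, underlying
  arrow, target).\<close>

definition slice :: "('o, 'm) cat \<Rightarrow> 'o \<Rightarrow> ('m, 'm \<times> 'm \<times> 'm) cat" where
  "slice C x =
     \<lparr>Ob = {a \<in> Ar C. Cod C a = x},
      Ar = {(a, h, b). a \<in> Ar C \<and> Cod C a = x \<and> b \<in> Ar C \<and> Cod C b = x \<and>
              h \<in> hom C (Dom C a) (Dom C b) \<and> b \<odot>\<^bsub>C\<^esub> h = a},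
      Dom = (\<lambda>(a, h, b). a),
      Cod = (\<lambda>(a, h, b). b),
      Id = (\<lambda>a. (a, Id C (Dom C a), a)),
      cmp = (\<lambda>(_, k, c) (a, h, _). (a, k \<odot>\<^bsub>C\<^esub> h, c))\<rparr>"

definition postcompose :: "('o, 'm) cat \<Rightarrow> 'm \<Rightarrow> ('m, 'm \<times> 'm \<times> 'm, 'm, 'm \<times> 'm \<times> 'm) ftr" where
  "postcompose C f =
     \<lparr>fob = (\<lambda>a. f \<odot>\<^bsub>C\<^esub> a), far = (\<lambda>(a, h, b). (f \<odot>\<^bsub>C\<^esub> a, h, f \<odot>\<^bsub>C\<^esub> b))\<rparr>"

text \<open>Adjoint triples \<open>lft \<stileturn> mid \<stileturn> rgt\<close> with \<open>lft, rgt : src \<rightarrow> tgt\<close> and \<open>mid : tgt \<rightarrow> src\<close>.\<close>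

record ('o, 'm, 'p, 'n) adj_triple =
  src :: "('o, 'm) cat"
  tgt :: "('p, 'n) cat"
  lft :: "('o, 'm, 'p, 'n) ftr"
  mid :: "('p, 'n, 'o, 'm) ftr"
  rgt :: "('o, 'm, 'p, 'n) ftr"
  unit_lm :: "'o \<Rightarrow> 'm"
  counit_lm :: "'p \<Rightarrow> 'n"
  unit_mr :: "'p \<Rightarrow> 'n"
  counit_mr :: "'o \<Rightarrow> 'm"

definition adjoint_triple :: "('o, 'm, 'p, 'n) adj_triple \<Rightarrow> bool" where
  "adjoint_triple T \<longleftrightarrow>
     adjunction (src T) (tgt T) (lft T) (mid T) (unit_lm T) (counit_lm T) \<and>
     adjunction (tgt T) (src T) (mid T) (rgt T) (unit_mr T) (counit_mr T)"

text \<open>The base change triple \<open>f\<^sub>! \<stileturn> f\<^sup>* \<stileturn> f\<^sub>*\<close> of \<open>f\<close>, where \<open>f\<^sub>!\<close> is composition with \<open>f\<close>. Its right adjoint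
  \<open>f\<^sup>*\<close> is pullback along \<open>f\<close> (the counit squares are pullback squares). The functors \<open>f\<^sup>*\<close> and \<open>f\<^sub>*\<close>,
  which exist in a topos, are only determined up to isomorphism; a triple records a choice of them.\<close>

definition base_change_triple ::
  "('o, 'm) cat \<Rightarrow> 'm \<Rightarrow> ('m, 'm \<times> 'm \<times> 'm, 'm, 'm \<times> 'm \<times> 'm) adj_triple \<Rightarrow> bool" where
  "base_change_triple H f T \<longleftrightarrow>
     src T = slice H (Dom H f) \<and> tgt T = slice H (Cod H f) \<and>
     lft T = postcompose H f \<and> adjoint_triple T"


section \<open>Disk bundles and jets\<close>

text \<open>In this and the next section \<open>T\<close> stands for the base change triple of the unit
  \<open>\<eta>\<^sub>\<Sigma> : \<Sigma> \<rightarrow> \<Im>\<Sigma>\<close>, so that \<open>src T\<close> is the slice over \<open>\<Sigma>\<close>.\<close>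

definition disk :: "('o, 'm, 'p, 'n) adj_triple \<Rightarrow> ('o, 'm, 'o, 'm) ftr" where
  "disk T = mid T \<circ>\<^sub>F lft T"

definition disk_unit :: "('o, 'm, 'p, 'n) adj_triple \<Rightarrow> 'o \<Rightarrow> 'm" where
  "disk_unit T = unit_lm T"

definition jet :: "('o, 'm, 'p, 'n) adj_triple \<Rightarrow> ('o, 'm, 'o, 'm) ftr" where
  "jet T = mid T \<circ>\<^sub>F rgt T"

definition jet_counit :: "('o, 'm, 'p, 'n) adj_triple \<Rightarrow> 'o \<Rightarrow> 'm" where
  "jet_counit T = counit_mr T"

definition jet_coproduct :: "('o, 'm, 'p, 'n) adj_triple \<Rightarrow> 'o \<Rightarrow> 'm" where
  "jet_coproduct T Y = far (mid T) (unit_mr T (fob (rgt T) Y))"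

text \<open>The adjunct \<open>X \<rightarrow> jet Y\<close> of \<open>\<sigma> : disk X \<rightarrow> Y\<close> under the composite of the two adjunctions.\<close>

definition adjunct :: "('o, 'm, 'p, 'n) adj_triple \<Rightarrow> 'o \<Rightarrow> 'm \<Rightarrow> 'm" where
  "adjunct T X \<sigma> =
     far (mid T) (far (rgt T) \<sigma> \<odot>\<^bsub>tgt T\<^esub> unit_mr T (fob (lft T) X)) \<odot>\<^bsub>src T\<^esub> unit_lm T X"


section \<open>Generalized PDEs\<close>

text \<open>A generalized PDE is a pair \<open>(Y, e)\<close>: the object \<open>Y\<close> cannot be recovered from \<open>e\<close>.\<close>

definition generalized_pde :: "('o, 'm, 'p, 'n) adj_triple \<Rightarrow> 'o \<times> 'm \<Rightarrow> bool" where
  "generalized_pde T = (\<lambda>(Y, e). Y \<in> Ob (src T) \<and> monic (src T) e \<and> Cod (src T) e = fob (jet T) Y)"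

definition holonomic_family :: "('o, 'm, 'p, 'n) adj_triple \<Rightarrow> 'o \<Rightarrow> 'o \<Rightarrow> 'm \<Rightarrow> bool" where
  "holonomic_family T Y E \<sigma> \<longleftrightarrow>
     \<sigma> \<in> hom (src T) (fob (disk T) E) (fob (jet T) Y) \<and>
     jet_coproduct T Y \<odot>\<^bsub>src T\<^esub> \<sigma> \<odot>\<^bsub>src T\<^esub> disk_unit T E = adjunct T E \<sigma>"

definition formal_solution_family :: "('o, 'm, 'p, 'n) adj_triple \<Rightarrow> 'o \<times> 'm \<Rightarrow> 'o \<Rightarrow> 'm \<Rightarrow> bool" where
  "formal_solution_family T = (\<lambda>(Y, e) E s.
     s \<in> hom (src T) (fob (disk T) E) (Dom (src T) e) \<and>
     holonomic_family T Y E (e \<odot>\<^bsub>src T\<^esub> s))"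

text \<open>\<open>e_inf\<close> and \<open>\<rho>_inf\<close> are the projections of the prolongation, which is determined up to isomorphism.\<close>

definition is_prolongation :: "('o, 'm, 'p, 'n) adj_triple \<Rightarrow> 'o \<times> 'm \<Rightarrow> 'm \<Rightarrow> 'm \<Rightarrow> bool" where
  "is_prolongation T = (\<lambda>(Y, e) e_inf \<rho>_inf.
     is_pullback (src T) (jet_coproduct T Y) (far (jet T) e) e_inf \<rho>_inf)"

definition formally_integrable :: "('o, 'm, 'p, 'n) adj_triple \<Rightarrow> 'o \<times> 'm \<Rightarrow> bool" where
  "formally_integrable T = (\<lambda>(Y, e). \<exists>e_inf \<rho>_inf. is_prolongation T (Y, e) e_inf \<rho>_inf \<and>
     iso (src T) (jet_counit T (Dom (src T) e) \<odot>\<^bsub>src T\<^esub> \<rho>_inf))"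

definition preserves_formal_solutions ::
  "('o, 'm, 'p, 'n) adj_triple \<Rightarrow> 'o \<times> 'm \<Rightarrow> 'o \<times> 'm \<Rightarrow> 'm \<Rightarrow> bool" where
  "preserves_formal_solutions T A B \<phi> \<longleftrightarrow>
     (\<forall>E \<in> Ob (src T). \<forall>s. formal_solution_family T A E s \<longrightarrow>
        formal_solution_family T B E (\<phi> \<odot>\<^bsub>src T\<^esub> s))"

definition PDE :: "('o, 'm, 'p, 'n) adj_triple \<Rightarrow>
    ('o \<times> 'm, ('o \<times> 'm) \<times> 'm \<times> ('o \<times> 'm)) cat" where
  "PDE T = (let Es = {A. generalized_pde T A \<and> formally_integrable T A} in
     \<lparr>Ob = Es,
      Ar = {(A, \<phi>, B). A \<in> Es \<and> B \<in> Es \<and>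
              \<phi> \<in> hom (src T) (Dom (src T) (snd A)) (Dom (src T) (snd B)) \<and>
              preserves_formal_solutions T A B \<phi>},
      Dom = (\<lambda>(A, \<phi>, B). A),
      Cod = (\<lambda>(A, \<phi>, B). B),
      Id = (\<lambda>A. (A, Id (src T) (Dom (src T) (snd A)), A)),
      cmp = (\<lambda>(_, \<psi>, C) (A, \<phi>, _). (A, \<psi> \<odot>\<^bsub>src T\<^esub> \<phi>, C))\<rparr>)"

definition PDE_in :: "('o, 'm, 'p, 'n) adj_triple \<Rightarrow> 'o set \<Rightarrow>
    ('o \<times> 'm, ('o \<times> 'm) \<times> 'm \<times> ('o \<times> 'm)) cat" where
  "PDE_in T X = full_subcat (PDE T) {(Y, e). Y \<in> X \<and> Dom (src T) e \<in> X}"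


section \<open>Coalgebras\<close>

text \<open>Coalgebras in \<open>C\<close> of a comonad with counit \<open>\<epsilon>\<close> and coproduct \<open>\<Delta>\<close>.\<close>

definition EM :: "('o, 'm) cat \<Rightarrow> ('o, 'm, 'o, 'm) ftr \<Rightarrow> ('o \<Rightarrow> 'm) \<Rightarrow> ('o \<Rightarrow> 'm) \<Rightarrow>
    ('o \<times> 'm, ('o \<times> 'm) \<times> 'm \<times> ('o \<times> 'm)) cat" where
  "EM C J \<epsilon> \<Delta> =
     (let As = {(E, \<rho>). E \<in> Ob C \<and> \<rho> \<in> hom C E (fob J E) \<and>
                  \<epsilon> E \<odot>\<^bsub>C\<^esub> \<rho> = Id C E \<and> far J \<rho> \<odot>\<^bsub>C\<^esub> \<rho> = \<Delta> E \<odot>\<^bsub>C\<^esub> \<rho>} in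
     \<lparr>Ob = As,
      Ar = {(A, \<phi>, B). A \<in> As \<and> B \<in> As \<and> \<phi> \<in> hom C (fst A) (fst B) \<and>
              snd B \<odot>\<^bsub>C\<^esub> \<phi> = far J \<phi> \<odot>\<^bsub>C\<^esub> snd A},
      Dom = (\<lambda>(A, \<phi>, B). A),
      Cod = (\<lambda>(A, \<phi>, B). B),
      Id = (\<lambda>A. (A, Id C (fst A), A)),
      cmp = (\<lambda>(_, \<psi>, D) (A, \<phi>, _). (A, \<psi> \<odot>\<^bsub>C\<^esub> \<phi>, D))\<rparr>)"

definition EM_jet :: "('o, 'm, 'p, 'n) adj_triple \<Rightarrow>
    ('o \<times> 'm, ('o \<times> 'm) \<times> 'm \<times> ('o \<times> 'm)) cat" where
  "EM_jet T = EM (src T) (jet T) (jet_counit T) (jet_coproduct T)"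

definition jet_closed :: "('o, 'm, 'p, 'n) adj_triple \<Rightarrow> 'o set \<Rightarrow> bool" where
  "jet_closed T X \<longleftrightarrow> X \<subseteq> Ob (src T) \<and> (\<forall>Y \<in> X. fob (jet T) Y \<in> X)"

text \<open>Coalgebras of the jet comonad restricted to the full subcategory on \<open>X\<close>.\<close>

definition EM_jet_in :: "('o, 'm, 'p, 'n) adj_triple \<Rightarrow> 'o set \<Rightarrow>
    ('o \<times> 'm, ('o \<times> 'm) \<times> 'm \<times> ('o \<times> 'm)) cat" where
  "EM_jet_in T X = EM (full_subcat (src T) X) (jet T) (jet_counit T) (jet_coproduct T)"

end

theory Submission
  imports Defs
begin

text \<open>A formally integrable PDE is a jet coalgebra together with an embedding of it into a cofree
  one. Write \<open>J\<close> for the jet comonad, \<open>\<epsilon>\<close> and \<open>\<Delta>\<close> for its counit and coproduct, and \<open>D\<close> for the disk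
  monad left adjoint to it. Everything takes place in the adjoint triple given by base change along
  the unit of \<open>\<Im>\<close>, so the argument is carried out for an adjoint triple of functors.

  Objects. Let \<open>e : \<E> \<rightarrow> J Y\<close> be a monomorphism. The counit law of \<open>J\<close> shows that
  every prolongation satisfies \<open>e\<^sup>\<infinity> = e \<odot> \<epsilon> \<odot> \<rho>\<^sup>\<infinity>\<close>. Hence, if \<open>\<epsilon> \<odot> \<rho>\<^sup>\<infinity>\<close> is invertible, composing \<open>\<rho>\<^sup>\<infinity>\<close>
  with its inverse gives a map \<open>\<rho> : \<E> \<rightarrow> J \<E>\<close> with \<open>J e \<odot> \<rho> = \<Delta> \<odot> e\<close> and \<open>\<epsilon> \<odot> \<rho> = id\<close>. As a composite of
  right adjoints \<open>J\<close> preserves monomorphisms, so \<open>\<rho>\<close> is the only map with the first property, and it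
  is coassociative because it is so after composition with \<open>J J e\<close> (\<open>integrable_coaction_exists\<close>,
  \<open>coaction_is_coalgebra\<close>). Conversely, the structure map \<open>\<rho> : \<E> \<rightarrow> J \<E>\<close> of a coalgebra is a split
  monomorphism, hence a PDE on \<open>Y = \<E>\<close>; its coassociativity square is a pullback, hence its own
  prolongation, and \<open>\<epsilon> \<odot> \<rho> = id\<close> is invertible (\<open>coalgebra_is_pde\<close>).

  Arrows. Cancelling \<open>J e\<close> in the equation of holonomicity, a formal solution is a map
  \<open>s : D E \<rightarrow> \<E>\<close> whose adjunct is \<open>\<rho> \<odot> s \<odot> \<eta>\<close> (\<open>formal_solution_iff\<close>), and this condition is
  visibly stable under coalgebra maps. The map \<open>a : D \<E> \<rightarrow> \<E>\<close> with adjunct \<open>\<rho>\<close>, the disk algebra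
  corresponding to the coalgebra, is itself a formal solution with \<open>a \<odot> \<eta> = id\<close>; that \<open>\<phi> \<odot> a\<close> is
  again a formal solution says exactly that \<open>\<phi>\<close> is a coalgebra map
  (\<open>preserves_formal_solutions_iff\<close>).

  So both categories consist of objects of the slice with extra structure and of slice arrows
  respecting it, and passing between \<open>e\<close> and \<open>\<rho>\<close> changes neither the underlying objects nor the
  arrows. If \<open>\<C>\<close> is closed under \<open>J\<close>, then a coalgebra on an object of \<open>\<C>\<close> is the same for \<open>J\<close>
  as for its restriction, and both passages stay inside \<open>\<C>\<close>, so the same pair of assignments gives the
  equivalence of the full subcategories.\<close>


section \<open>Calculating in categories and functors\<close>

lemma category_Dom_Cod [simp]:
  assumes "category C" "f \<in> Ar C"
  shows "Dom C f \<in> Ob C" "Cod C f \<in> Ob C"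
  using assms unfolding category_def by auto

lemma category_Id [simp]:
  assumes "category C" "a \<in> Ob C"
  shows "Id C a \<in> Ar C" "Dom C (Id C a) = a" "Cod C (Id C a) = a"
  using assms unfolding category_def hom_def by auto

lemma category_comp [simp]:
  assumes "category C" "f \<in> Ar C" "g \<in> Ar C" "Dom C g = Cod C f"
  shows "g \<odot>\<^bsub>C\<^esub> f \<in> Ar C" "Dom C (g \<odot>\<^bsub>C\<^esub> f) = Dom C f" "Cod C (g \<odot>\<^bsub>C\<^esub> f) = Cod C g"
  using assms unfolding category_def hom_def by auto

lemma category_unit_laws [simp]:
  assumes "category C" "f \<in> Ar C"
  shows "a = Dom C f \<Longrightarrow> f \<odot>\<^bsub>C\<^esub> Id C a = f" "b = Cod C f \<Longrightarrow> Id C b \<odot>\<^bsub>C\<^esub> f = f"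
  using assms unfolding category_def by auto

lemma category_assoc:
  assumes "category C" "f \<in> Ar C" "g \<in> Ar C" "h \<in> Ar C" "Dom C g = Cod C f" "Dom C h = Cod C g"
  shows "(h \<odot>\<^bsub>C\<^esub> g) \<odot>\<^bsub>C\<^esub> f = h \<odot>\<^bsub>C\<^esub> (g \<odot>\<^bsub>C\<^esub> f)"
  using assms unfolding category_def by auto

lemma ftr_simps:
  assumes "is_ftr C D F"
  shows "a \<in> Ob C \<Longrightarrow> fob F a \<in> Ob D"
    and "f \<in> Ar C \<Longrightarrow> far F f \<in> Ar D"
    and "f \<in> Ar C \<Longrightarrow> Dom D (far F f) = fob F (Dom C f)"
    and "f \<in> Ar C \<Longrightarrow> Cod D (far F f) = fob F (Cod C f)"
    and "a \<in> Ob C \<Longrightarrow> far F (Id C a) = Id D (fob F a)"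
    and "f \<in> Ar C \<Longrightarrow> g \<in> Ar C \<Longrightarrow> Dom C g = Cod C f \<Longrightarrow>
      far F (g \<odot>\<^bsub>C\<^esub> f) = far F g \<odot>\<^bsub>D\<^esub> far F f"
  using assms unfolding is_ftr_def hom_def by auto

lemma ftr_categories:
  assumes "is_ftr C D F"
  shows "category C" "category D"
  using assms unfolding is_ftr_def by auto

lemma fob_comp_ftr [simp]: "fob (G \<circ>\<^sub>F F) a = fob G (fob F a)"
  and far_comp_ftr [simp]: "far (G \<circ>\<^sub>F F) f = far G (far F f)"
  by (simp_all add: comp_ftr_def)

lemma fob_id_ftr [simp]: "fob id_ftr a = a"
  and far_id_ftr [simp]: "far id_ftr f = f"
  by (simp_all add: id_ftr_def)

lemma is_ftr_comp:
  assumes F: "is_ftr C D F" and G: "is_ftr D E G"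
  shows "is_ftr C E (G \<circ>\<^sub>F F)"
  unfolding is_ftr_def
  using ftr_categories[OF F] ftr_categories[OF G]
  by (auto simp: hom_def ftr_simps[OF F] ftr_simps[OF G])

lemma nat_trans_simps:
  assumes "nat_trans C D F G \<tau>"
  shows "a \<in> Ob C \<Longrightarrow> \<tau> a \<in> Ar D"
    and "a \<in> Ob C \<Longrightarrow> Dom D (\<tau> a) = fob F a"
    and "a \<in> Ob C \<Longrightarrow> Cod D (\<tau> a) = fob G a"
  using assms unfolding nat_trans_def hom_def by auto

lemma naturality:
  assumes "nat_trans C D F G \<tau>" "f \<in> Ar C"
  shows "\<tau> (Cod C f) \<odot>\<^bsub>D\<^esub> far F f = far G f \<odot>\<^bsub>D\<^esub> \<tau> (Dom C f)"
  using assms unfolding nat_trans_def by auto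

lemma monicD:
  assumes "monic C m" "g \<in> Ar C" "h \<in> Ar C" "Cod C g = Dom C m" "Cod C h = Dom C m"
    "Dom C g = Dom C h" "m \<odot>\<^bsub>C\<^esub> g = m \<odot>\<^bsub>C\<^esub> h"
  shows "g = h"
  using assms unfolding monic_def by blast

lemma split_monic:
  assumes C: "category C" and m: "m \<in> Ar C" and r: "r \<in> Ar C" "Dom C r = Cod C m"
    and rm: "r \<odot>\<^bsub>C\<^esub> m = Id C (Dom C m)"
  shows "monic C m"
  unfolding monic_def
proof (intro conjI ballI impI m)
  fix g h
  assume g: "g \<in> Ar C" and h: "h \<in> Ar C"
    and *: "Cod C g = Dom C m \<and> Cod C h = Dom C m \<and> Dom C g = Dom C h \<and> m \<odot>\<^bsub>C\<^esub> g = m \<odot>\<^bsub>C\<^esub> h"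
  have "g = (r \<odot>\<^bsub>C\<^esub> m) \<odot>\<^bsub>C\<^esub> g" using C g * by (simp add: rm)
  also have "\<dots> = (r \<odot>\<^bsub>C\<^esub> m) \<odot>\<^bsub>C\<^esub> h" using C m r g h * by (simp add: category_assoc)
  also have "\<dots> = h" using C h * by (simp add: rm)
  finally show "g = h" .
qed

text \<open>Maps into the image of a right adjoint are recovered from their transposes, and transposition
  turns composition with \<open>far G m\<close> into composition with \<open>m\<close>.\<close>

lemma right_adjoint_preserves_monic:
  assumes adj: "adjunction C D F G \<eta> \<epsilon>" and m: "monic D m"
  shows "monic C (far G m)"
proof -
  have F: "is_ftr C D F" and G: "is_ftr D C G"
    and \<eta>: "nat_trans C C id_ftr (G \<circ>\<^sub>F F) \<eta>" and \<epsilon>: "nat_trans D D (F \<circ>\<^sub>F G) id_ftr \<epsilon>"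
    and tri: "\<And>b. b \<in> Ob D \<Longrightarrow> far G (\<epsilon> b) \<odot>\<^bsub>C\<^esub> \<eta> (fob G b) = Id C (fob G b)"
    using adj unfolding adjunction_def by auto
  note cats [simp] = ftr_categories[OF F]
  note [simp] = ftr_simps[OF F] ftr_simps[OF G] nat_trans_simps[OF \<eta>] nat_trans_simps[OF \<epsilon>]
  have mA [simp]: "m \<in> Ar D" using m unfolding monic_def by auto
  show ?thesis
    unfolding monic_def
  proof (intro conjI ballI impI)
    fix g h
    assume g [simp]: "g \<in> Ar C" and h [simp]: "h \<in> Ar C"
      and *: "Cod C g = Dom C (far G m) \<and> Cod C h = Dom C (far G m) \<and> Dom C g = Dom C h \<and>
        far G m \<odot>\<^bsub>C\<^esub> g = far G m \<odot>\<^bsub>C\<^esub> h"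
    let ?b = "Dom D m"
    have cod [simp]: "Cod C g = fob G ?b" "Cod C h = fob G ?b" using * by auto
    have dom: "Dom C h = Dom C g" using * by auto
    have transpose: "m \<odot>\<^bsub>D\<^esub> (\<epsilon> ?b \<odot>\<^bsub>D\<^esub> far F k) = \<epsilon> (Cod D m) \<odot>\<^bsub>D\<^esub> far F (far G m \<odot>\<^bsub>C\<^esub> k)"
      if [simp]: "k \<in> Ar C" "Cod C k = fob G ?b" for k
    proof -
      have "m \<odot>\<^bsub>D\<^esub> (\<epsilon> ?b \<odot>\<^bsub>D\<^esub> far F k) = (m \<odot>\<^bsub>D\<^esub> \<epsilon> ?b) \<odot>\<^bsub>D\<^esub> far F k"
        by (simp add: category_assoc)
      also have "m \<odot>\<^bsub>D\<^esub> \<epsilon> ?b = \<epsilon> (Cod D m) \<odot>\<^bsub>D\<^esub> far F (far G m)"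
        using naturality[OF \<epsilon> mA] by simp
      finally show ?thesis by (simp add: category_assoc)
    qed
    have "\<epsilon> ?b \<odot>\<^bsub>D\<^esub> far F g = \<epsilon> ?b \<odot>\<^bsub>D\<^esub> far F h"
      by (rule monicD[OF m]) (use * in \<open>simp_all add: transpose dom\<close>)
    moreover have "far G (\<epsilon> ?b \<odot>\<^bsub>D\<^esub> far F k) \<odot>\<^bsub>C\<^esub> \<eta> (Dom C k) = k"
      if k [simp]: "k \<in> Ar C" "Cod C k = fob G ?b" for k
    proof -
      have "far G (\<epsilon> ?b \<odot>\<^bsub>D\<^esub> far F k) \<odot>\<^bsub>C\<^esub> \<eta> (Dom C k)
          = far G (\<epsilon> ?b) \<odot>\<^bsub>C\<^esub> (far G (far F k) \<odot>\<^bsub>C\<^esub> \<eta> (Dom C k))"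
        by (simp add: category_assoc)
      also have "far G (far F k) \<odot>\<^bsub>C\<^esub> \<eta> (Dom C k) = \<eta> (fob G ?b) \<odot>\<^bsub>C\<^esub> k"
        using naturality[OF \<eta> k(1)] by simp
      also have "far G (\<epsilon> ?b) \<odot>\<^bsub>C\<^esub> (\<eta> (fob G ?b) \<odot>\<^bsub>C\<^esub> k) = k"
        by (simp add: category_assoc[symmetric] tri)
      finally show ?thesis .
    qed
    ultimately show "g = h" by (metis g h cod dom)
  qed simp
qed

lemma iso_Id:
  assumes "category C" "a \<in> Ob C"
  shows "iso C (Id C a)"
  unfolding iso_def hom_def using assms by (intro conjI bexI[of _ "Id C a"]) auto

lemma category_full_subcat:
  assumes "category C"
  shows "category (full_subcat C X)"
  using assms unfolding category_def full_subcat_def hom_def by auto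

lemma full_subcat_inclusion_fully_faithful:
  assumes "category C"
  shows "fully_faithful (full_subcat C X) C id_ftr"
proof -
  have "hom (full_subcat C X) a b = hom C a b" if "a \<in> X" "b \<in> X" for a b
    using that unfolding full_subcat_def hom_def by auto
  moreover have "is_ftr (full_subcat C X) C id_ftr"
    using assms category_full_subcat[OF assms, of X] unfolding is_ftr_def
    by (auto simp: full_subcat_def hom_def)
  ultimately show ?thesis
    unfolding fully_faithful_def id_ftr_def by (auto simp: full_subcat_def bij_betw_def)
qed


section \<open>Categories of objects with structure\<close>

text \<open>The elements of \<open>As\<close> are objects of \<open>C\<close> with structure, \<open>u\<close> is the underlying object, and
  \<open>P A \<phi> B\<close> says that the arrow \<open>\<phi>\<close> of \<open>C\<close> respects the structures \<open>A\<close> and \<open>B\<close>. Both PDEs and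
  coalgebras are of this kind.\<close>

definition structured_cat ::
  "('o, 'm) cat \<Rightarrow> 'a set \<Rightarrow> ('a \<Rightarrow> 'o) \<Rightarrow> ('a \<Rightarrow> 'm \<Rightarrow> 'a \<Rightarrow> bool) \<Rightarrow> ('a, 'a \<times> 'm \<times> 'a) cat" where
  "structured_cat C As u P =
     \<lparr>Ob = As,
      Ar = {(A, \<phi>, B). A \<in> As \<and> B \<in> As \<and> \<phi> \<in> hom C (u A) (u B) \<and> P A \<phi> B},
      Dom = (\<lambda>(A, \<phi>, B). A),
      Cod = (\<lambda>(A, \<phi>, B). B),
      Id = (\<lambda>A. (A, Id C (u A), A)),
      cmp = (\<lambda>(_, \<psi>, D) (A, \<phi>, _). (A, \<psi> \<odot>\<^bsub>C\<^esub> \<phi>, D))\<rparr>"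

lemma category_structured_cat:
  assumes "category C"
    and "\<And>A. A \<in> As \<Longrightarrow> u A \<in> Ob C"
    and "\<And>A. A \<in> As \<Longrightarrow> P A (Id C (u A)) A"
    and "\<And>A B D \<phi> \<psi>. \<lbrakk>A \<in> As; B \<in> As; D \<in> As; \<phi> \<in> hom C (u A) (u B); \<psi> \<in> hom C (u B) (u D);
      P A \<phi> B; P B \<psi> D\<rbrakk> \<Longrightarrow> P A (\<psi> \<odot>\<^bsub>C\<^esub> \<phi>) D"
  shows "category (structured_cat C As u P)"
  using assms unfolding category_def[of "structured_cat C As u P"] unfolding structured_cat_def
  by (auto simp: hom_def category_assoc)

lemma full_subcat_structured_cat:
  "full_subcat (structured_cat C As u P) X = structured_cat C (As \<inter> X) u P"
  unfolding full_subcat_def structured_cat_def by auto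

definition structure_ftr :: "('a \<Rightarrow> 'b) \<Rightarrow> ('a, 'a \<times> 'm \<times> 'a, 'b, 'b \<times> 'm \<times> 'b) ftr" where
  "structure_ftr g = \<lparr>fob = g, far = (\<lambda>(A, \<phi>, B). (g A, \<phi>, g B))\<rparr>"

lemma is_ftr_structure_ftr:
  assumes "category (structured_cat C As u P)" "category (structured_cat C Bs v Q)"
    and "\<And>A. A \<in> As \<Longrightarrow> g A \<in> Bs \<and> v (g A) = u A"
    and "\<And>A B \<phi>. \<lbrakk>A \<in> As; B \<in> As; \<phi> \<in> hom C (u A) (u B); P A \<phi> B\<rbrakk> \<Longrightarrow> Q (g A) \<phi> (g B)"
  shows "is_ftr (structured_cat C As u P) (structured_cat C Bs v Q) (structure_ftr g)"
  using assms unfolding is_ftr_def by (auto simp: structured_cat_def structure_ftr_def hom_def)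

lemma is_ftr_id:
  assumes "category C"
  shows "is_ftr C C id_ftr"
  using assms by (simp add: is_ftr_def hom_def)

text \<open>If \<open>g\<close> preserves and reflects the arrows and has a section \<open>h\<close>, then \<open>A\<close> and \<open>h (g A)\<close> have
  the same image under \<open>g\<close>. The identity of the underlying object therefore respects both structures
  and is the natural isomorphism between them.\<close>

lemma equivalence_structure_ftr:
  assumes C: "category C"
    and v: "\<And>B. B \<in> Bs \<Longrightarrow> v B \<in> Ob C"
    and Q_id: "\<And>B. B \<in> Bs \<Longrightarrow> Q B (Id C (v B)) B"
    and Q_comp: "\<And>A B D \<phi> \<psi>. \<lbrakk>A \<in> Bs; B \<in> Bs; D \<in> Bs; \<phi> \<in> hom C (v A) (v B);
      \<psi> \<in> hom C (v B) (v D); Q A \<phi> B; Q B \<psi> D\<rbrakk> \<Longrightarrow> Q A (\<psi> \<odot>\<^bsub>C\<^esub> \<phi>) D"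
    and g: "\<And>A. A \<in> As \<Longrightarrow> g A \<in> Bs" "\<And>A. A \<in> As \<Longrightarrow> v (g A) = u A"
    and h: "\<And>B. B \<in> Bs \<Longrightarrow> h B \<in> As" "\<And>B. B \<in> Bs \<Longrightarrow> g (h B) = B"
    and PQ: "\<And>A B \<phi>. \<lbrakk>A \<in> As; B \<in> As; \<phi> \<in> hom C (u A) (u B)\<rbrakk> \<Longrightarrow> P A \<phi> B \<longleftrightarrow> Q (g A) \<phi> (g B)"
  shows "category (structured_cat C As u P)"
    and "category (structured_cat C Bs v Q)"
    and "equivalence (structured_cat C As u P) (structured_cat C Bs v Q) (structure_ftr g)"
proof -
  let ?A = "structured_cat C As u P" and ?B = "structured_cat C Bs v Q"
  have u: "u A \<in> Ob C" if "A \<in> As" for A using v g that by metis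
  have Id_hom: "Id C a \<in> hom C a a" if "a \<in> Ob C" for a using C that by (simp add: hom_def)
  have comp_hom: "\<psi> \<odot>\<^bsub>C\<^esub> \<phi> \<in> hom C a c" if "\<phi> \<in> hom C a b" "\<psi> \<in> hom C b c" for a b c \<phi> \<psi>
    using C that by (auto simp: hom_def)
  have uh: "u (h B) = v B" if "B \<in> Bs" for B using g(2)[of "h B"] h that by simp
  show catB: "category ?B" by (rule category_structured_cat) (use assms in auto)
  show catA: "category ?A"
  proof (rule category_structured_cat[OF C u])
    fix A assume "A \<in> As"
    then show "P A (Id C (u A)) A" using Q_id[of "g A"] by (simp add: PQ g u Id_hom)
  next
    fix A B D \<phi> \<psi>
    assume "A \<in> As" "B \<in> As" "D \<in> As" "\<phi> \<in> hom C (u A) (u B)" "\<psi> \<in> hom C (u B) (u D)"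
      "P A \<phi> B" "P B \<psi> D"
    then show "P A (\<psi> \<odot>\<^bsub>C\<^esub> \<phi>) D"
      using Q_comp[of "g A" "g B" "g D" \<phi> \<psi>] comp_hom[of \<phi> "u A" "u B" \<psi> "u D"] by (simp add: PQ g)
  qed
  have G: "is_ftr ?A ?B (structure_ftr g)"
    by (rule is_ftr_structure_ftr[OF catA catB]) (auto simp: g PQ)
  have H: "is_ftr ?B ?A (structure_ftr h)"
    by (rule is_ftr_structure_ftr[OF catB catA]) (auto simp: h PQ uh)
  have P_unit: "P A (Id C (u A)) (h (g A))" "P (h (g A)) (Id C (u A)) A" if "A \<in> As" for A
    using that Q_id[of "g A"] uh[of "g A"] Id_hom[OF u[OF that]] by (simp_all add: PQ g h)
  let ?\<eta> = "\<lambda>A. (A, Id C (u A), h (g A))"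
  have "nat_iso ?A ?A id_ftr (structure_ftr h \<circ>\<^sub>F structure_ftr g) ?\<eta>"
    unfolding nat_iso_def nat_trans_def
  proof (intro conjI ballI)
    show "is_ftr ?A ?A id_ftr" by (rule is_ftr_id[OF catA])
    show "is_ftr ?A ?A (structure_ftr h \<circ>\<^sub>F structure_ftr g)" by (rule is_ftr_comp[OF G H])
    fix A assume "A \<in> Ob ?A"
    then have A: "A \<in> As" by (simp add: structured_cat_def)
    have uhg: "u (h (g A)) = u A" using A by (simp add: uh g)
    show "?\<eta> A \<in> hom ?A (fob id_ftr A) (fob (structure_ftr h \<circ>\<^sub>F structure_ftr g) A)"
      unfolding hom_def[of ?A]
      using A P_unit[OF A] Id_hom[OF u[OF A]]
      by (simp add: structured_cat_def structure_ftr_def uhg g h)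
    show "iso ?A (?\<eta> A)"
      unfolding iso_def hom_def[of ?A]
      using A P_unit[OF A] Id_hom[OF u[OF A]] C u[OF A]
      by (intro conjI bexI[of _ "(h (g A), Id C (u A), A)"])
        (simp_all add: structured_cat_def uhg g h)
  next
    fix f assume "f \<in> Ar ?A"
    then show "?\<eta> (Cod ?A f) \<odot>\<^bsub>?A\<^esub> far id_ftr f
        = far (structure_ftr h \<circ>\<^sub>F structure_ftr g) f \<odot>\<^bsub>?A\<^esub> ?\<eta> (Dom ?A f)"
      using C by (auto simp: structured_cat_def structure_ftr_def hom_def)
  qed
  moreover have "nat_iso ?B ?B (structure_ftr g \<circ>\<^sub>F structure_ftr h) id_ftr (Id ?B)"
    unfolding nat_iso_def nat_trans_def
  proof (intro conjI ballI)
    show "is_ftr ?B ?B id_ftr" by (rule is_ftr_id[OF catB])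
    show "is_ftr ?B ?B (structure_ftr g \<circ>\<^sub>F structure_ftr h)" by (rule is_ftr_comp[OF H G])
    fix B assume B: "B \<in> Ob ?B"
    then have gh: "fob (structure_ftr g \<circ>\<^sub>F structure_ftr h) B = B"
      by (simp add: structured_cat_def structure_ftr_def h)
    show "Id ?B B \<in> hom ?B (fob (structure_ftr g \<circ>\<^sub>F structure_ftr h) B) (fob id_ftr B)"
      unfolding gh using catB B by (simp add: hom_def)
    show "iso ?B (Id ?B B)" by (rule iso_Id[OF catB B])
  next
    fix f assume f: "f \<in> Ar ?B"
    then have "far (structure_ftr g \<circ>\<^sub>F structure_ftr h) f = f"
      by (auto simp: structured_cat_def structure_ftr_def h)
    then show "Id ?B (Cod ?B f) \<odot>\<^bsub>?B\<^esub> far (structure_ftr g \<circ>\<^sub>F structure_ftr h) f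
        = far id_ftr f \<odot>\<^bsub>?B\<^esub> Id ?B (Dom ?B f)"
      using catB f by simp
  qed
  ultimately show "equivalence ?A ?B (structure_ftr g)"
    unfolding equivalence_def using G H by blast
qed


section \<open>The jet comonad of an adjoint triple\<close>

locale jet_setting =
  fixes T :: "('o, 'm, 'p, 'n) adj_triple"
  assumes triple: "adjoint_triple T"
begin

abbreviation comp_src :: "'m \<Rightarrow> 'm \<Rightarrow> 'm"  (infixr "\<cdot>" 70) where
  "g \<cdot> f \<equiv> g \<odot>\<^bsub>src T\<^esub> f"

abbreviation comp_tgt :: "'n \<Rightarrow> 'n \<Rightarrow> 'n"  (infixr "\<star>" 70) where
  "g \<star> f \<equiv> g \<odot>\<^bsub>tgt T\<^esub> f"

abbreviation "J \<equiv> jet T"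
abbreviation "\<epsilon> \<equiv> jet_counit T"
abbreviation "\<Delta> \<equiv> jet_coproduct T"

lemma adjunction_lm: "adjunction (src T) (tgt T) (lft T) (mid T) (unit_lm T) (counit_lm T)"
  and adjunction_mr: "adjunction (tgt T) (src T) (mid T) (rgt T) (unit_mr T) (counit_mr T)"
  using triple unfolding adjoint_triple_def by auto

lemma lft_ftr: "is_ftr (src T) (tgt T) (lft T)"
  and mid_ftr: "is_ftr (tgt T) (src T) (mid T)"
  and rgt_ftr: "is_ftr (src T) (tgt T) (rgt T)"
  using adjunction_lm adjunction_mr unfolding adjunction_def by auto

lemma jet_ftr: "is_ftr (src T) (src T) J"
  unfolding jet_def by (rule is_ftr_comp[OF rgt_ftr mid_ftr])

lemma fob_jet: "fob J a = fob (mid T) (fob (rgt T) a)"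
  and far_jet: "far J f = far (mid T) (far (rgt T) f)"
  by (simp_all add: jet_def)

lemma nat_unit_lm: "nat_trans (src T) (src T) id_ftr (mid T \<circ>\<^sub>F lft T) (unit_lm T)"
  and nat_counit_lm: "nat_trans (tgt T) (tgt T) (lft T \<circ>\<^sub>F mid T) id_ftr (counit_lm T)"
  and nat_unit_mr: "nat_trans (tgt T) (tgt T) id_ftr (rgt T \<circ>\<^sub>F mid T) (unit_mr T)"
  and nat_counit_mr: "nat_trans (src T) (src T) (mid T \<circ>\<^sub>F rgt T) id_ftr (counit_mr T)"
  using adjunction_lm adjunction_mr unfolding adjunction_def by auto

lemma mid_triangle_lm: "b \<in> Ob (tgt T) \<Longrightarrow>
    far (mid T) (counit_lm T b) \<cdot> unit_lm T (fob (mid T) b) = Id (src T) (fob (mid T) b)"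
  and mid_triangle_mr: "b \<in> Ob (tgt T) \<Longrightarrow>
    counit_mr T (fob (mid T) b) \<cdot> far (mid T) (unit_mr T b) = Id (src T) (fob (mid T) b)"
  and rgt_triangle_mr: "a \<in> Ob (src T) \<Longrightarrow>
    far (rgt T) (counit_mr T a) \<star> unit_mr T (fob (rgt T) a) = Id (tgt T) (fob (rgt T) a)"
  using adjunction_lm adjunction_mr unfolding adjunction_def by auto

lemmas triple_simps [simp] =
  ftr_categories[OF lft_ftr]
  ftr_simps[OF lft_ftr] ftr_simps[OF mid_ftr] ftr_simps[OF rgt_ftr] ftr_simps[OF jet_ftr]
  nat_trans_simps[OF nat_unit_lm, simplified] nat_trans_simps[OF nat_counit_lm, simplified]
  nat_trans_simps[OF nat_unit_mr, simplified] nat_trans_simps[OF nat_counit_mr, simplified]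

lemma jet_counit_simps [simp]:
  assumes "Y \<in> Ob (src T)"
  shows "\<epsilon> Y \<in> Ar (src T)" "Dom (src T) (\<epsilon> Y) = fob J Y" "Cod (src T) (\<epsilon> Y) = Y"
  using assms by (simp_all add: jet_counit_def fob_jet)

lemma jet_coproduct_simps [simp]:
  assumes "Y \<in> Ob (src T)"
  shows "\<Delta> Y \<in> Ar (src T)" "Dom (src T) (\<Delta> Y) = fob J Y" "Cod (src T) (\<Delta> Y) = fob J (fob J Y)"
  using assms by (simp_all add: jet_coproduct_def fob_jet)

lemma disk_unit_simps [simp]:
  assumes "E \<in> Ob (src T)"
  shows "disk_unit T E \<in> Ar (src T)" "Dom (src T) (disk_unit T E) = E"
    "Cod (src T) (disk_unit T E) = fob (disk T) E"
  using assms by (simp_all add: disk_unit_def disk_def)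

lemma disk_Ob [simp]: "E \<in> Ob (src T) \<Longrightarrow> fob (disk T) E \<in> Ob (src T)"
  by (simp add: disk_def)

lemma jet_counit_natural:
  assumes "f \<in> Ar (src T)"
  shows "\<epsilon> (Cod (src T) f) \<cdot> far J f = f \<cdot> \<epsilon> (Dom (src T) f)"
  using naturality[OF nat_counit_mr assms] by (simp add: jet_counit_def far_jet)

lemma jet_coproduct_natural:
  assumes "f \<in> Ar (src T)"
  shows "\<Delta> (Cod (src T) f) \<cdot> far J f = far J (far J f) \<cdot> \<Delta> (Dom (src T) f)"
proof -
  have "far (mid T) (unit_mr T (fob (rgt T) (Cod (src T) f)) \<star> far (rgt T) f)
      = far (mid T) (far (rgt T) (far (mid T) (far (rgt T) f)) \<star> unit_mr T (fob (rgt T) (Dom (src T) f)))"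
    using naturality[OF nat_unit_mr, of "far (rgt T) f"] assms by simp
  then show ?thesis using assms by (simp add: jet_coproduct_def far_jet)
qed

lemma jet_counit_coproduct:
  assumes "Y \<in> Ob (src T)"
  shows "\<epsilon> (fob J Y) \<cdot> \<Delta> Y = Id (src T) (fob J Y)"
  using mid_triangle_mr[of "fob (rgt T) Y"] assms
  by (simp add: jet_counit_def jet_coproduct_def fob_jet)

lemma jet_map_counit_coproduct:
  assumes "Y \<in> Ob (src T)"
  shows "far J (\<epsilon> Y) \<cdot> \<Delta> Y = Id (src T) (fob J Y)"
proof -
  have "far J (\<epsilon> Y) \<cdot> \<Delta> Y
      = far (mid T) (far (rgt T) (counit_mr T Y) \<star> unit_mr T (fob (rgt T) Y))"
    using assms by (simp add: jet_counit_def jet_coproduct_def far_jet fob_jet)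
  then show ?thesis using assms by (simp add: rgt_triangle_mr fob_jet)
qed

lemma jet_coproduct_coassoc:
  assumes "Y \<in> Ob (src T)"
  shows "far J (\<Delta> Y) \<cdot> \<Delta> Y = \<Delta> (fob J Y) \<cdot> \<Delta> Y"
proof -
  let ?u = "unit_mr T (fob (rgt T) Y)"
  have "far (mid T) (unit_mr T (Cod (tgt T) ?u) \<star> ?u)
      = far (mid T) (far (rgt T) (far (mid T) ?u) \<star> ?u)"
    using naturality[OF nat_unit_mr, of ?u] assms by simp
  then show ?thesis using assms by (simp add: jet_coproduct_def far_jet fob_jet)
qed

lemma jet_preserves_monic: "monic (src T) e \<Longrightarrow> monic (src T) (far J e)"
  unfolding far_jet
  by (intro right_adjoint_preserves_monic[OF adjunction_lm]
      right_adjoint_preserves_monic[OF adjunction_mr])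

lemma adjunct_simps [simp]:
  assumes "X \<in> Ob (src T)" "\<sigma> \<in> Ar (src T)" "Dom (src T) \<sigma> = fob (disk T) X"
  shows "adjunct T X \<sigma> \<in> Ar (src T)" "Dom (src T) (adjunct T X \<sigma>) = X"
    "Cod (src T) (adjunct T X \<sigma>) = fob J (Cod (src T) \<sigma>)"
  using assms by (simp_all add: adjunct_def disk_def fob_jet)

lemma adjunct_comp:
  assumes [simp]: "X \<in> Ob (src T)" "\<sigma> \<in> Ar (src T)" "Dom (src T) \<sigma> = fob (disk T) X"
    "\<phi> \<in> Ar (src T)" "Dom (src T) \<phi> = Cod (src T) \<sigma>"
  shows "adjunct T X (\<phi> \<cdot> \<sigma>) = far J \<phi> \<cdot> adjunct T X \<sigma>"
  using assms(3) unfolding disk_def by (simp add: adjunct_def far_jet category_assoc)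

lemma jet_counit_adjunct:
  assumes X [simp]: "X \<in> Ob (src T)" and \<sigma> [simp]: "\<sigma> \<in> Ar (src T)"
    and dom: "Dom (src T) \<sigma> = fob (disk T) X"
  shows "\<epsilon> (Cod (src T) \<sigma>) \<cdot> adjunct T X \<sigma> = \<sigma> \<cdot> disk_unit T X"
proof -
  have dom' [simp]: "Dom (src T) \<sigma> = fob (mid T) (fob (lft T) X)" using dom by (simp add: disk_def)
  let ?u = "far (mid T) (unit_mr T (fob (lft T) X))" and ?Y = "Cod (src T) \<sigma>"
  have "\<epsilon> ?Y \<cdot> adjunct T X \<sigma> = (\<epsilon> ?Y \<cdot> far J \<sigma>) \<cdot> (?u \<cdot> unit_lm T X)"
    by (simp add: adjunct_def far_jet fob_jet jet_counit_def category_assoc)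
  also have "\<dots> = (\<sigma> \<cdot> \<epsilon> (Dom (src T) \<sigma>)) \<cdot> (?u \<cdot> unit_lm T X)"
    by (simp add: jet_counit_natural del: dom')
  also have "\<dots> = \<sigma> \<cdot> ((counit_mr T (fob (mid T) (fob (lft T) X)) \<cdot> ?u) \<cdot> unit_lm T X)"
    by (simp add: jet_counit_def category_assoc)
  also have "\<dots> = \<sigma> \<cdot> disk_unit T X"
    by (simp add: mid_triangle_mr disk_unit_def)
  finally show ?thesis .
qed

text \<open>The preimage of \<open>\<rho>\<close> is its transpose under first the left and then the right adjunction of the
  triple; the two triangle identities undo these steps one after the other.\<close>

lemma adjunct_surj:
  assumes X [simp]: "X \<in> Ob (src T)" and Y [simp]: "Y \<in> Ob (src T)"
    and \<rho>: "\<rho> \<in> hom (src T) X (fob J Y)"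
  obtains \<sigma> where "\<sigma> \<in> hom (src T) (fob (disk T) X) Y" "adjunct T X \<sigma> = \<rho>"
proof -
  have \<rho>_simps [simp]: "\<rho> \<in> Ar (src T)" "Dom (src T) \<rho> = X"
    "Cod (src T) \<rho> = fob (mid T) (fob (rgt T) Y)"
    using \<rho> by (auto simp: hom_def fob_jet)
  let ?t = "counit_lm T (fob (rgt T) Y) \<star> far (lft T) \<rho>"
  have t [simp]: "?t \<in> Ar (tgt T)" "Dom (tgt T) ?t = fob (lft T) X" "Cod (tgt T) ?t = fob (rgt T) Y"
    by simp_all
  have "far (rgt T) (counit_mr T Y \<cdot> far (mid T) ?t) \<star> unit_mr T (fob (lft T) X)
      = far (rgt T) (counit_mr T Y) \<star>
          (far (rgt T) (far (mid T) ?t) \<star> unit_mr T (Dom (tgt T) ?t))"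
    by (simp add: category_assoc)
  also have "far (rgt T) (far (mid T) ?t) \<star> unit_mr T (Dom (tgt T) ?t)
      = unit_mr T (Cod (tgt T) ?t) \<star> ?t"
    using naturality[OF nat_unit_mr t(1)] by simp
  also have "far (rgt T) (counit_mr T Y) \<star> (unit_mr T (Cod (tgt T) ?t) \<star> ?t)
      = (far (rgt T) (counit_mr T Y) \<star> unit_mr T (fob (rgt T) Y)) \<star> ?t"
    by (simp add: category_assoc)
  also have "\<dots> = ?t" by (simp add: rgt_triangle_mr)
  finally have mr: "far (rgt T) (counit_mr T Y \<cdot> far (mid T) ?t) \<star> unit_mr T (fob (lft T) X) = ?t" .
  have "far (mid T) ?t \<cdot> unit_lm T X
      = far (mid T) (counit_lm T (fob (rgt T) Y)) \<cdot>
          (far (mid T) (far (lft T) \<rho>) \<cdot> unit_lm T (Dom (src T) \<rho>))"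
    by (simp add: category_assoc)
  also have "far (mid T) (far (lft T) \<rho>) \<cdot> unit_lm T (Dom (src T) \<rho>)
      = unit_lm T (Cod (src T) \<rho>) \<cdot> \<rho>"
    using naturality[OF nat_unit_lm \<rho>_simps(1)] by simp
  also have "far (mid T) (counit_lm T (fob (rgt T) Y)) \<cdot> (unit_lm T (Cod (src T) \<rho>) \<cdot> \<rho>)
      = (far (mid T) (counit_lm T (fob (rgt T) Y)) \<cdot> unit_lm T (fob (mid T) (fob (rgt T) Y))) \<cdot> \<rho>"
    by (simp add: category_assoc)
  also have "\<dots> = \<rho>" by (simp add: mid_triangle_lm)
  finally have "adjunct T X (counit_mr T Y \<cdot> far (mid T) ?t) = \<rho>"
    unfolding adjunct_def mr .
  moreover have "counit_mr T Y \<cdot> far (mid T) ?t \<in> hom (src T) (fob (disk T) X) Y"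
    by (simp add: hom_def disk_def)
  ultimately show ?thesis using that by blast
qed


section \<open>Formally integrable PDEs and jet coalgebras\<close>

text \<open>The equation says that \<open>e\<close> is a coalgebra map from \<open>\<rho>\<close> to the cofree coalgebra on \<open>Y\<close>.\<close>

definition is_coaction :: "'o \<times> 'm \<Rightarrow> 'm \<Rightarrow> bool" where
  "is_coaction = (\<lambda>(Y, e) \<rho>. \<rho> \<in> hom (src T) (Dom (src T) e) (fob J (Dom (src T) e)) \<and>
     \<Delta> Y \<cdot> e = far J e \<cdot> \<rho>)"

definition coaction :: "'o \<times> 'm \<Rightarrow> 'm" where
  "coaction A = (THE \<rho>. is_coaction A \<rho>)"

definition is_coalgebra :: "'o \<times> 'm \<Rightarrow> bool" where
  "is_coalgebra = (\<lambda>(E, \<rho>). E \<in> Ob (src T) \<and> \<rho> \<in> hom (src T) E (fob J E) \<and>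
     \<epsilon> E \<cdot> \<rho> = Id (src T) E \<and> far J \<rho> \<cdot> \<rho> = \<Delta> E \<cdot> \<rho>)"

definition coalgebra_arrow :: "'o \<times> 'm \<Rightarrow> 'm \<Rightarrow> 'o \<times> 'm \<Rightarrow> bool" where
  "coalgebra_arrow A \<phi> B \<longleftrightarrow> snd B \<cdot> \<phi> = far J \<phi> \<cdot> snd A"

lemma pde_simps:
  assumes "generalized_pde T (Y, e)"
  shows "Y \<in> Ob (src T)" "e \<in> Ar (src T)" "Cod (src T) e = fob J Y" "Dom (src T) e \<in> Ob (src T)"
  using assms unfolding generalized_pde_def monic_def by auto

lemma pde_jet_cancel:
  assumes pde: "generalized_pde T (Y, e)"
    and "g \<in> hom (src T) X (fob J (Dom (src T) e))" "h \<in> hom (src T) X (fob J (Dom (src T) e))"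
    and "far J e \<cdot> g = far J e \<cdot> h"
  shows "g = h"
proof (rule monicD)
  show "monic (src T) (far J e)"
    using pde unfolding generalized_pde_def by (auto intro: jet_preserves_monic)
qed (use assms pde_simps[OF pde] in \<open>auto simp: hom_def\<close>)

lemma coaction_eqI:
  assumes pde: "generalized_pde T (Y, e)" and \<rho>: "is_coaction (Y, e) \<rho>"
  shows "coaction (Y, e) = \<rho>"
  unfolding coaction_def
proof (rule the_equality[of "is_coaction (Y, e)", OF \<rho>])
  fix \<rho>' assume \<rho>': "is_coaction (Y, e) \<rho>'"
  have "far J e \<cdot> \<rho>' = far J e \<cdot> \<rho>"
    using \<rho> \<rho>' by (simp add: is_coaction_def)
  with pde _ _ show "\<rho>' = \<rho>"
    by (rule pde_jet_cancel) (use \<rho> \<rho>' in \<open>auto simp: is_coaction_def\<close>)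
qed

text \<open>The counit law identifies \<open>e_inf\<close> with \<open>e \<cdot> k\<close>, where \<open>k = \<epsilon> \<cdot> \<rho>_inf\<close>. So inverting \<open>k\<close> turns the
  pullback square into the equation of a coaction for \<open>e\<close>.\<close>

lemma integrable_coaction_exists:
  assumes pde: "generalized_pde T (Y, e)" and int: "formally_integrable T (Y, e)"
  obtains \<rho> where "is_coaction (Y, e) \<rho>"
    "\<epsilon> (Dom (src T) e) \<cdot> \<rho> = Id (src T) (Dom (src T) e)"
proof -
  note [simp] = pde_simps[OF pde]
  let ?E = "Dom (src T) e"
  obtain e_inf \<rho>_inf where pb: "is_pullback (src T) (\<Delta> Y) (far J e) e_inf \<rho>_inf"
    and iso: "iso (src T) (\<epsilon> ?E \<cdot> \<rho>_inf)"
    using int unfolding formally_integrable_def is_prolongation_def by auto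
  have [simp]: "e_inf \<in> Ar (src T)" "\<rho>_inf \<in> Ar (src T)" "Dom (src T) e_inf = Dom (src T) \<rho>_inf"
    "Cod (src T) e_inf = fob J Y" "Cod (src T) \<rho>_inf = fob J ?E"
    and square: "\<Delta> Y \<cdot> e_inf = far J e \<cdot> \<rho>_inf"
    using pb unfolding is_pullback_def by auto
  let ?k = "\<epsilon> ?E \<cdot> \<rho>_inf"
  obtain k' where [simp]: "k' \<in> Ar (src T)" "Dom (src T) k' = ?E" "Cod (src T) k' = Dom (src T) \<rho>_inf"
    and kk': "?k \<cdot> k' = Id (src T) ?E"
    using iso unfolding iso_def hom_def by auto
  have "e_inf = (\<epsilon> (fob J Y) \<cdot> \<Delta> Y) \<cdot> e_inf"
    by (simp add: jet_counit_coproduct)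
  also have "\<dots> = (\<epsilon> (Cod (src T) e) \<cdot> far J e) \<cdot> \<rho>_inf"
    by (simp add: category_assoc square)
  \<comment> \<open>Naturality is stated at \<open>Cod e\<close>, which must not be rewritten to \<open>J Y\<close> before it is used.\<close>
  also have "\<dots> = e \<cdot> ?k"
    by (simp add: jet_counit_natural category_assoc del: pde_simps(3)[OF pde])
  finally have e_inf: "e_inf = e \<cdot> ?k" .
  have "\<Delta> Y \<cdot> e = \<Delta> Y \<cdot> (e \<cdot> (?k \<cdot> k'))"
    unfolding kk' by simp
  also have "\<dots> = (\<Delta> Y \<cdot> (e \<cdot> ?k)) \<cdot> k'"
    by (simp add: category_assoc)
  also have "\<dots> = far J e \<cdot> (\<rho>_inf \<cdot> k')"
    unfolding e_inf[symmetric] square by (simp add: category_assoc)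
  finally have "is_coaction (Y, e) (\<rho>_inf \<cdot> k')"
    by (simp add: is_coaction_def hom_def)
  moreover have "\<epsilon> ?E \<cdot> (\<rho>_inf \<cdot> k') = Id (src T) ?E"
    using kk' by (simp add: category_assoc)
  ultimately show ?thesis using that by blast
qed

lemma is_coaction_coaction:
  assumes "generalized_pde T (Y, e)" "formally_integrable T (Y, e)"
  shows "is_coaction (Y, e) (coaction (Y, e))"
proof -
  obtain \<rho> where "is_coaction (Y, e) \<rho>" using integrable_coaction_exists[OF assms] by auto
  then show ?thesis using coaction_eqI[OF assms(1)] by simp
qed

text \<open>Coassociativity is inherited along \<open>e\<close> from the cofree coalgebra on \<open>Y\<close>.\<close>

lemma coaction_is_coalgebra:
  assumes pde: "generalized_pde T (Y, e)" and int: "formally_integrable T (Y, e)"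
  shows "is_coalgebra (Dom (src T) e, coaction (Y, e))"
proof -
  note [simp] = pde_simps[OF pde]
  let ?E = "Dom (src T) e"
  obtain \<rho> where co: "is_coaction (Y, e) \<rho>" and counit: "\<epsilon> ?E \<cdot> \<rho> = Id (src T) ?E"
    using integrable_coaction_exists[OF pde int] .
  have [simp]: "\<rho> \<in> Ar (src T)" "Dom (src T) \<rho> = ?E" "Cod (src T) \<rho> = fob J ?E"
    and eq: "\<Delta> Y \<cdot> e = far J e \<cdot> \<rho>"
    using co by (auto simp: is_coaction_def hom_def)
  have "far J (far J e) \<cdot> (far J \<rho> \<cdot> \<rho>) = far J (\<Delta> Y \<cdot> e) \<cdot> \<rho>"
    unfolding eq by (simp add: category_assoc)
  also have "\<dots> = far J (\<Delta> Y) \<cdot> (\<Delta> Y \<cdot> e)"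
    by (simp add: category_assoc flip: eq)
  also have "\<dots> = (far J (\<Delta> Y) \<cdot> \<Delta> Y) \<cdot> e"
    by (simp add: category_assoc)
  also have "\<dots> = \<Delta> (fob J Y) \<cdot> (\<Delta> Y \<cdot> e)"
    by (simp add: jet_coproduct_coassoc category_assoc)
  also have "\<dots> = (\<Delta> (Cod (src T) e) \<cdot> far J e) \<cdot> \<rho>"
    by (simp add: eq category_assoc)
  also have "\<dots> = far J (far J e) \<cdot> (\<Delta> ?E \<cdot> \<rho>)"
    by (simp add: jet_coproduct_natural category_assoc del: pde_simps(3)[OF pde])
  finally have *: "far J (far J e) \<cdot> (far J \<rho> \<cdot> \<rho>) = far J (far J e) \<cdot> (\<Delta> ?E \<cdot> \<rho>)" .
  have "monic (src T) (far J (far J e))"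
    using pde unfolding generalized_pde_def by (auto intro: jet_preserves_monic)
  from this _ _ _ _ _ * have "far J \<rho> \<cdot> \<rho> = \<Delta> ?E \<cdot> \<rho>"
    by (rule monicD) simp_all
  then show ?thesis
    by (simp add: coaction_eqI[OF pde co] is_coalgebra_def hom_def counit)
qed

text \<open>The structure map \<open>\<rho>\<close> is split by \<open>\<epsilon> E\<close>. If \<open>\<Delta> \<cdot> u = J \<rho> \<cdot> v\<close>, then composing with \<open>\<epsilon>\<close> gives
  \<open>u = \<rho> \<cdot> \<epsilon> \<cdot> v\<close> and composing with \<open>J \<epsilon>\<close> gives \<open>u = v\<close>, so the pair factors through \<open>\<rho>\<close>:
  the coassociativity square is a pullback.\<close>

lemma coalgebra_is_pde:
  assumes "is_coalgebra (E, \<rho>)"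
  shows "generalized_pde T (E, \<rho>)" "formally_integrable T (E, \<rho>)" "coaction (E, \<rho>) = \<rho>"
    "Dom (src T) \<rho> = E"
proof -
  have E [simp]: "E \<in> Ob (src T)" and \<rho> [simp]: "\<rho> \<in> Ar (src T)" "Dom (src T) \<rho> = E"
    "Cod (src T) \<rho> = fob J E"
    and counit: "\<epsilon> E \<cdot> \<rho> = Id (src T) E" and coassoc: "far J \<rho> \<cdot> \<rho> = \<Delta> E \<cdot> \<rho>"
    using assms by (auto simp: is_coalgebra_def hom_def)
  have mono: "monic (src T) \<rho>"
    by (rule split_monic[where r = "\<epsilon> E"]) (simp_all add: counit)
  show pde: "generalized_pde T (E, \<rho>)"
    using mono by (simp add: generalized_pde_def)
  show "Dom (src T) \<rho> = E" by simp
  show "coaction (E, \<rho>) = \<rho>"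
    by (rule coaction_eqI[OF pde]) (simp add: is_coaction_def hom_def coassoc)
  have "is_pullback (src T) (\<Delta> E) (far J \<rho>) \<rho> \<rho>"
    unfolding is_pullback_def
  proof (intro conjI ballI impI)
    fix x u v
    assume x: "x \<in> Ob (src T)"
      and "u \<in> hom (src T) x (Dom (src T) (\<Delta> E))" "v \<in> hom (src T) x (Dom (src T) (far J \<rho>))"
      and uv: "\<Delta> E \<cdot> u = far J \<rho> \<cdot> v"
    then have [simp]: "u \<in> Ar (src T)" "Dom (src T) u = x" "Cod (src T) u = fob J E"
      "v \<in> Ar (src T)" "Dom (src T) v = x" "Cod (src T) v = fob J E"
      by (auto simp: hom_def)
    have "u = (\<epsilon> (fob J E) \<cdot> \<Delta> E) \<cdot> u" by (simp add: jet_counit_coproduct)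
    also have "\<dots> = (\<epsilon> (Cod (src T) \<rho>) \<cdot> far J \<rho>) \<cdot> v" by (simp add: category_assoc uv)
    also have "\<dots> = (\<rho> \<cdot> \<epsilon> (Dom (src T) \<rho>)) \<cdot> v"
      by (simp only: jet_counit_natural[OF \<rho>(1)])
    also have "\<dots> = \<rho> \<cdot> (\<epsilon> E \<cdot> v)"
      by (simp add: category_assoc)
    finally have u: "u = \<rho> \<cdot> (\<epsilon> E \<cdot> v)" .
    have "u = (far J (\<epsilon> E) \<cdot> \<Delta> E) \<cdot> u" by (simp add: jet_map_counit_coproduct)
    also have "\<dots> = far J (\<epsilon> E \<cdot> \<rho>) \<cdot> v" by (simp add: category_assoc uv)
    also have "\<dots> = v" by (simp add: counit)
    finally have v: "u = v" .
    show "\<exists>!h. h \<in> hom (src T) x (Dom (src T) \<rho>) \<and> \<rho> \<cdot> h = u \<and> \<rho> \<cdot> h = v"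
    proof (rule ex1I[of _ "\<epsilon> E \<cdot> v"])
      have "\<epsilon> E \<cdot> v \<in> hom (src T) x (Dom (src T) \<rho>)" by (simp add: hom_def)
      then show "\<epsilon> E \<cdot> v \<in> hom (src T) x (Dom (src T) \<rho>) \<and> \<rho> \<cdot> (\<epsilon> E \<cdot> v) = u \<and> \<rho> \<cdot> (\<epsilon> E \<cdot> v) = v"
        using u v by metis
      fix h assume h: "h \<in> hom (src T) x (Dom (src T) \<rho>) \<and> \<rho> \<cdot> h = u \<and> \<rho> \<cdot> h = v"
      then have "\<rho> \<cdot> h = \<rho> \<cdot> (\<epsilon> E \<cdot> v)" using u by metis
      from mono _ _ _ _ _ this show "h = \<epsilon> E \<cdot> v"
        by (rule monicD) (use h in \<open>simp_all add: hom_def\<close>)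
    qed
  qed (simp_all add: coassoc)
  moreover have "iso (src T) (\<epsilon> E \<cdot> \<rho>)"
    unfolding counit by (rule iso_Id) simp_all
  ultimately show "formally_integrable T (E, \<rho>)"
    unfolding formally_integrable_def is_prolongation_def by auto
qed


section \<open>Formal solutions in terms of the coaction\<close>

text \<open>Both sides of the equation of holonomicity for \<open>e \<cdot> s\<close> are composites with \<open>J e\<close>, which can be
  cancelled.\<close>

lemma formal_solution_iff:
  assumes pde: "generalized_pde T (Y, e)" and co: "is_coaction (Y, e) \<rho>" and E [simp]: "E \<in> Ob (src T)"
  shows "formal_solution_family T (Y, e) E s \<longleftrightarrow>
    s \<in> hom (src T) (fob (disk T) E) (Dom (src T) e) \<and> \<rho> \<cdot> s \<cdot> disk_unit T E = adjunct T E s"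
proof (cases "s \<in> hom (src T) (fob (disk T) E) (Dom (src T) e)")
  case True
  note [simp] = pde_simps[OF pde]
  have [simp]: "s \<in> Ar (src T)" "Dom (src T) s = fob (disk T) E" "Cod (src T) s = Dom (src T) e"
    using True by (auto simp: hom_def)
  have [simp]: "\<rho> \<in> Ar (src T)" "Dom (src T) \<rho> = Dom (src T) e" "Cod (src T) \<rho> = fob J (Dom (src T) e)"
    and eq: "\<Delta> Y \<cdot> e = far J e \<cdot> \<rho>"
    using co by (auto simp: is_coaction_def hom_def)
  have "\<Delta> Y \<cdot> (e \<cdot> s) \<cdot> disk_unit T E = (\<Delta> Y \<cdot> e) \<cdot> (s \<cdot> disk_unit T E)"
    by (simp add: category_assoc)
  also have "\<dots> = far J e \<cdot> (\<rho> \<cdot> s \<cdot> disk_unit T E)"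
    unfolding eq by (simp add: category_assoc)
  finally have lhs: "\<Delta> Y \<cdot> (e \<cdot> s) \<cdot> disk_unit T E = far J e \<cdot> (\<rho> \<cdot> s \<cdot> disk_unit T E)" .
  have rhs: "adjunct T E (e \<cdot> s) = far J e \<cdot> adjunct T E s"
    by (rule adjunct_comp) simp_all
  have "\<rho> \<cdot> s \<cdot> disk_unit T E = adjunct T E s"
    if "far J e \<cdot> (\<rho> \<cdot> s \<cdot> disk_unit T E) = far J e \<cdot> adjunct T E s"
    by (rule pde_jet_cancel[OF pde _ _ that]) (simp_all add: hom_def)
  then show ?thesis
    using True unfolding formal_solution_family_def holonomic_family_def prod.case lhs rhs
    by (auto simp: hom_def)
qed (simp add: formal_solution_family_def)

text \<open>Testing on the single formal solution \<open>a\<close> whose adjunct is the coaction of the source suffices: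
  it satisfies \<open>a \<cdot> \<eta> = id\<close>, so the equation for \<open>\<phi> \<cdot> a\<close> becomes that of a coalgebra map.\<close>

lemma preserves_formal_solutions_iff:
  assumes pde: "generalized_pde T (Y, e)" and int: "formally_integrable T (Y, e)"
    and pde': "generalized_pde T (Y', e')" and int': "formally_integrable T (Y', e')"
    and \<phi>: "\<phi> \<in> hom (src T) (Dom (src T) e) (Dom (src T) e')"
  shows "preserves_formal_solutions T (Y, e) (Y', e') \<phi> \<longleftrightarrow>
    coaction (Y', e') \<cdot> \<phi> = far J \<phi> \<cdot> coaction (Y, e)"
proof -
  let ?E = "Dom (src T) e" and ?E' = "Dom (src T) e'"
  let ?\<rho> = "coaction (Y, e)" and ?\<rho>' = "coaction (Y', e')"
  note [simp] = pde_simps[OF pde] pde_simps[OF pde']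
  note co = is_coaction_coaction[OF pde int] and co' = is_coaction_coaction[OF pde' int']
  note solution = formal_solution_iff[OF pde co] and solution' = formal_solution_iff[OF pde' co']
  have \<rho>: "?\<rho> \<in> hom (src T) ?E (fob J ?E)" and \<rho>': "?\<rho>' \<in> hom (src T) ?E' (fob J ?E')"
    using co co' by (auto simp: is_coaction_def)
  have [simp]: "?\<rho> \<in> Ar (src T)" "Dom (src T) ?\<rho> = ?E" "Cod (src T) ?\<rho> = fob J ?E"
    "?\<rho>' \<in> Ar (src T)" "Dom (src T) ?\<rho>' = ?E'" "Cod (src T) ?\<rho>' = fob J ?E'"
    "\<phi> \<in> Ar (src T)" "Dom (src T) \<phi> = ?E" "Cod (src T) \<phi> = ?E'"
    using \<rho> \<rho>' \<phi> by (auto simp: hom_def)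
  show ?thesis
  proof
    assume pres: "preserves_formal_solutions T (Y, e) (Y', e') \<phi>"
    obtain a where a: "a \<in> hom (src T) (fob (disk T) ?E) ?E" and adj: "adjunct T ?E a = ?\<rho>"
      using adjunct_surj[OF _ _ \<rho>] by auto
    have [simp]: "a \<in> Ar (src T)" "Dom (src T) a = fob (disk T) ?E" "Cod (src T) a = ?E"
      using a by (auto simp: hom_def)
    have "a \<cdot> disk_unit T ?E = \<epsilon> ?E \<cdot> ?\<rho>"
      using jet_counit_adjunct[of ?E a] by (simp add: adj)
    also have "\<dots> = Id (src T) ?E"
      using coaction_is_coalgebra[OF pde int] by (simp add: is_coalgebra_def)
    finally have unit: "a \<cdot> disk_unit T ?E = Id (src T) ?E" .
    then have "formal_solution_family T (Y, e) ?E a"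
      using a by (simp add: solution adj)
    then have "formal_solution_family T (Y', e') ?E (\<phi> \<cdot> a)"
      using pres unfolding preserves_formal_solutions_def by simp
    then have "?\<rho>' \<cdot> (\<phi> \<cdot> a) \<cdot> disk_unit T ?E = far J \<phi> \<cdot> ?\<rho>"
      by (simp add: solution' adjunct_comp adj)
    then show "?\<rho>' \<cdot> \<phi> = far J \<phi> \<cdot> ?\<rho>"
      by (simp add: category_assoc unit)
  next
    assume map: "?\<rho>' \<cdot> \<phi> = far J \<phi> \<cdot> ?\<rho>"
    show "preserves_formal_solutions T (Y, e) (Y', e') \<phi>"
      unfolding preserves_formal_solutions_def
    proof (intro ballI allI impI)
      fix E s assume E [simp]: "E \<in> Ob (src T)" and "formal_solution_family T (Y, e) E s"
      then have s [simp]: "s \<in> Ar (src T)" "Dom (src T) s = fob (disk T) E" "Cod (src T) s = ?E"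
        and sol: "?\<rho> \<cdot> s \<cdot> disk_unit T E = adjunct T E s"
        by (auto simp: solution hom_def)
      have "?\<rho>' \<cdot> (\<phi> \<cdot> s) \<cdot> disk_unit T E = (?\<rho>' \<cdot> \<phi>) \<cdot> (s \<cdot> disk_unit T E)"
        by (simp add: category_assoc)
      also have "\<dots> = far J \<phi> \<cdot> (?\<rho> \<cdot> s \<cdot> disk_unit T E)"
        unfolding map by (simp add: category_assoc)
      also have "\<dots> = adjunct T E (\<phi> \<cdot> s)"
        by (simp add: sol adjunct_comp)
      finally show "formal_solution_family T (Y', e') E (\<phi> \<cdot> s)"
        by (simp add: solution' hom_def)
    qed
  qed
qed


section \<open>The equivalence\<close>

lemma PDE_structured:
  "PDE T = structured_cat (src T) {A. generalized_pde T A \<and> formally_integrable T A}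
    (\<lambda>A. Dom (src T) (snd A)) (\<lambda>A \<phi> B. preserves_formal_solutions T A B \<phi>)"
  unfolding PDE_def structured_cat_def Let_def by simp

lemma EM_jet_structured:
  "EM_jet T = structured_cat (src T) {A. is_coalgebra A} fst coalgebra_arrow"
  unfolding EM_jet_def EM_def structured_cat_def Let_def is_coalgebra_def coalgebra_arrow_def
  by (simp add: case_prod_unfold)

lemma EM_jet_in_full_subcat:
  assumes "jet_closed T X"
  shows "EM_jet_in T X = full_subcat (EM_jet T) {A. fst A \<in> X}"
proof -
  have hom: "hom (full_subcat (src T) X) a b = hom (src T) a b" if "a \<in> X" "b \<in> X" for a b
    using that unfolding full_subcat_def hom_def by auto
  have J: "fob J Y \<in> X" if "Y \<in> X" for Y using assms that unfolding jet_closed_def by auto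
  have fields: "Ob (full_subcat (src T) X) = Ob (src T) \<inter> X" "Id (full_subcat (src T) X) = Id (src T)"
    "cmp (full_subcat (src T) X) = cmp (src T)"
    by (simp_all add: full_subcat_def)
  show ?thesis
    unfolding EM_jet_structured full_subcat_structured_cat
    unfolding EM_jet_in_def EM_def Let_def fields structured_cat_def is_coalgebra_def coalgebra_arrow_def
    by (auto simp: hom J)
qed

definition pde_to_coalgebra :: "'o \<times> 'm \<Rightarrow> 'o \<times> 'm" where
  "pde_to_coalgebra A = (Dom (src T) (snd A), coaction A)"

text \<open>The inverse assignment is the identity on pairs: a coalgebra \<open>(E, \<rho>)\<close> is read as the PDE \<open>\<rho>\<close>
  on \<open>Y = E\<close>. The same pair of
  assignments works between any two full subcategories that it maps into each other.\<close>

lemma PDE_EM_equivalence_restricted: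
  assumes fwd: "\<And>A. A \<in> X \<Longrightarrow> pde_to_coalgebra A \<in> X'"
    and bwd: "\<And>A. is_coalgebra A \<Longrightarrow> A \<in> X' \<Longrightarrow> A \<in> X"
  shows "category (full_subcat (PDE T) X)" and "category (full_subcat (EM_jet T) X')"
    and "equivalence (full_subcat (PDE T) X) (full_subcat (EM_jet T) X')
      (structure_ftr pde_to_coalgebra)"
proof -
  let ?As = "{A. generalized_pde T A \<and> formally_integrable T A} \<inter> X"
  let ?Bs = "{A. is_coalgebra A} \<inter> X'"
  have Q_id: "coalgebra_arrow B (Id (src T) (fst B)) B" if "B \<in> ?Bs" for B
    using that by (auto simp: is_coalgebra_def coalgebra_arrow_def hom_def)
  have Q_comp: "coalgebra_arrow A (\<psi> \<cdot> \<phi>) D"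
    if A: "A \<in> ?Bs" and B: "B \<in> ?Bs" and D: "D \<in> ?Bs" and \<phi>: "\<phi> \<in> hom (src T) (fst A) (fst B)"
      and \<psi>: "\<psi> \<in> hom (src T) (fst B) (fst D)"
      and 1: "coalgebra_arrow A \<phi> B" and 2: "coalgebra_arrow B \<psi> D" for A B D \<phi> \<psi>
  proof -
    have [simp]: "snd A \<in> Ar (src T)" "Dom (src T) (snd A) = fst A" "Cod (src T) (snd A) = fob J (fst A)"
      "snd B \<in> Ar (src T)" "Dom (src T) (snd B) = fst B" "Cod (src T) (snd B) = fob J (fst B)"
      "snd D \<in> Ar (src T)" "Dom (src T) (snd D) = fst D" "Cod (src T) (snd D) = fob J (fst D)"
      "\<phi> \<in> Ar (src T)" "Dom (src T) \<phi> = fst A" "Cod (src T) \<phi> = fst B"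
      "\<psi> \<in> Ar (src T)" "Dom (src T) \<psi> = fst B" "Cod (src T) \<psi> = fst D"
      using A B D \<phi> \<psi> by (auto simp: is_coalgebra_def hom_def)
    have "snd D \<cdot> (\<psi> \<cdot> \<phi>) = (snd D \<cdot> \<psi>) \<cdot> \<phi>" by (simp add: category_assoc)
    also have "\<dots> = far J \<psi> \<cdot> (snd B \<cdot> \<phi>)"
      using 2 by (simp add: coalgebra_arrow_def category_assoc)
    also have "\<dots> = far J (\<psi> \<cdot> \<phi>) \<cdot> snd A"
      using 1 by (simp add: coalgebra_arrow_def category_assoc)
    finally show ?thesis by (simp add: coalgebra_arrow_def)
  qed
  have g: "pde_to_coalgebra A \<in> ?Bs" "fst (pde_to_coalgebra A) = Dom (src T) (snd A)"
    if "A \<in> ?As" for A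
    using that fwd coaction_is_coalgebra[of "fst A" "snd A"] by (auto simp: pde_to_coalgebra_def)
  have h: "B \<in> ?As" "pde_to_coalgebra B = B" if "B \<in> ?Bs" for B
    using that bwd[of B] coalgebra_is_pde[of "fst B" "snd B"]
    by (auto simp: pde_to_coalgebra_def prod_eq_iff)
  have PQ: "preserves_formal_solutions T A B \<phi> \<longleftrightarrow>
      coalgebra_arrow (pde_to_coalgebra A) \<phi> (pde_to_coalgebra B)"
    if "A \<in> ?As" "B \<in> ?As" "\<phi> \<in> hom (src T) (Dom (src T) (snd A)) (Dom (src T) (snd B))" for A B \<phi>
    using that preserves_formal_solutions_iff[of "fst A" "snd A" "fst B" "snd B" \<phi>]
    by (simp add: coalgebra_arrow_def pde_to_coalgebra_def)
  have Ob: "fst B \<in> Ob (src T)" if "B \<in> ?Bs" for B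
    using that by (auto simp: is_coalgebra_def)
  have src: "category (src T)" by simp
  note * = equivalence_structure_ftr[where Bs = ?Bs and As = ?As and v = fst and Q = coalgebra_arrow
      and g = pde_to_coalgebra and h = "\<lambda>B. B", OF src Ob Q_id Q_comp g h PQ]
  show "category (full_subcat (PDE T) X)"
    unfolding PDE_structured full_subcat_structured_cat by (rule *(1))
  show "category (full_subcat (EM_jet T) X')"
    unfolding EM_jet_structured full_subcat_structured_cat by (rule *(2))
  show "equivalence (full_subcat (PDE T) X) (full_subcat (EM_jet T) X')
      (structure_ftr pde_to_coalgebra)"
    unfolding PDE_structured EM_jet_structured full_subcat_structured_cat by (rule *(3))
qed

end

lemma full_subcat_UNIV: "full_subcat C UNIV = (C :: ('o, 'm) cat)"
  unfolding full_subcat_def by simp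

theorem theorem3p52:
  fixes K :: "('o, 'm, 'p, 'n) diff_cohesion"
    and V \<Sigma> :: 'o
    and T :: "('m, 'm \<times> 'm \<times> 'm, 'm, 'm \<times> 'm \<times> 'm) adj_triple"
  assumes "grothendieck_universe TYPE('u)"
    and "differentially_cohesive_topos TYPE('u) K"
    and "group_object (ambient K) V"
    and "V_manifold K V \<Sigma>"
    and "base_change_triple (ambient K) (Im_unit K \<Sigma>) T"
  shows "\<exists>\<Phi>. equivalence (PDE T) (EM_jet T) \<Phi> \<and>
    (\<forall>\<C>. jet_closed T \<C> \<longrightarrow>
       fully_faithful (PDE_in T \<C>) (PDE T) id_ftr \<and>
       fully_faithful (EM_jet_in T \<C>) (EM_jet T) id_ftr \<and>
       (\<exists>\<Phi>\<^sub>\<C>. equivalence (PDE_in T \<C>) (EM_jet_in T \<C>) \<Phi>\<^sub>\<C> \<and>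
          ftr_eq (PDE_in T \<C>) (\<Phi> \<circ>\<^sub>F id_ftr) (id_ftr \<circ>\<^sub>F \<Phi>\<^sub>\<C>)))"
proof -
  interpret jet_setting T
    by unfold_locales (use assms(5) in \<open>simp add: base_change_triple_def\<close>)
  let ?\<Phi> = "structure_ftr pde_to_coalgebra"
  note total = PDE_EM_equivalence_restricted[of UNIV UNIV, unfolded full_subcat_UNIV, simplified]
  show ?thesis
  proof (rule exI[of _ ?\<Phi>], intro conjI allI impI)
    show "equivalence (PDE T) (EM_jet T) ?\<Phi>" by (rule total(3))
    fix \<C> assume closed: "jet_closed T \<C>"
    show "fully_faithful (PDE_in T \<C>) (PDE T) id_ftr"
      unfolding PDE_in_def by (rule full_subcat_inclusion_fully_faithful[OF total(1)])
    show "fully_faithful (EM_jet_in T \<C>) (EM_jet T) id_ftr"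
      unfolding EM_jet_in_full_subcat[OF closed]
      by (rule full_subcat_inclusion_fully_faithful[OF total(2)])
    have "equivalence (PDE_in T \<C>) (EM_jet_in T \<C>) ?\<Phi>"
      unfolding PDE_in_def EM_jet_in_full_subcat[OF closed]
      by (rule PDE_EM_equivalence_restricted(3))
        (auto simp: pde_to_coalgebra_def coalgebra_is_pde)
    moreover have "ftr_eq (PDE_in T \<C>) (?\<Phi> \<circ>\<^sub>F id_ftr) (id_ftr \<circ>\<^sub>F ?\<Phi>)"
      by (simp add: ftr_eq_def)
    ultimately show "\<exists>\<Phi>\<^sub>\<C>. equivalence (PDE_in T \<C>) (EM_jet_in T \<C>) \<Phi>\<^sub>\<C> \<and>
        ftr_eq (PDE_in T \<C>) (?\<Phi> \<circ>\<^sub>F id_ftr) (id_ftr \<circ>\<^sub>F \<Phi>\<^sub>\<C>)"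
      by blast
  qed
qed

end
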